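(* Let $X$ and $Y$ be tropical cycles in $N_{\mathbb R}$ with positive multiplicities. Then for any generic $v\in N_{\mathbb R}$ (that is, for all $v$ in some dense open subset of $N_{\mathbb R}$ depending on $X$ and $Y$), $$\operatorname{supp}(X\cdot Y)=\lim_{\varepsilon\to 0}\ \operatorname{supp}(X)\cap(\operatorname{supp}(Y)+\varepsilon v).$$ In particular, the limit set does not depend on the choice of generic $v$.
   Context: Let $N\cong\mathbb Z^n$ be a lattice and $N_{\mathbb R}=N\otimes_{\mathbb Z}\mathbb R$. Polyhedral complexes are finite and rational (each polyhedron is a finite intersection of half-spaces $\{x:\langle u,x\rangle\le c\}$ with $u\in\operatorname{Hom}(N,\mathbb Z)$, $c\in\mathbb R$). For a polyhedron $\sigma$, $N_\sigma$ is the maximal sublattice of $N$ parallel to the affine span of $\sigma$. A tropical $k$-cycle $X$ is a pure $k$-dimensional polyhedral complex in which every facet $\sigma$ carries a multiplicity $\operatorname{mult}_X(\sigma)\in\mathbb Q$ and which is balanced: for each ridge (codimension-one face) $\tau$, $\sum_{\sigma\supset\tau}\operatorname{mult}_X(\sigma)v_{\sigma/\tau}\in\operatorname{span}_{\mathbb Q}(N_\tau)$, the sum being over facets $\sigma\supset\tau$, where $v_{\sigma/\tau}\in N$ points from $\tau$ into $\sigma$ and generates $N_\sigma$ together with $N_\tau$. Facets of multiplicity $0$ are ignored, and cycles with a common refinement carrying equal multiplicities are identified. $\operatorname{supp}(X)$ is the union of the closed facets of nonzero multiplicity. "Positive multiplicities" means all facet multiplicities are $>0$. Links: for a polyhedron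 $\sigma\ni\omega$, $\operatorname{link}_\omega(\sigma)=\{u:\omega+\varepsilon u\in\sigma\text{ for all sufficiently small }\varepsilon>0\}$; $\operatorname{link}_\omega(X)=\{\operatorname{link}_\omega(\sigma):\omega\in\sigma\in X\}$ with inherited multiplicities (empty if $\omega\notin\operatorname{supp}(X)$). Stable intersection (support): for tropical cycles $X,Y$ with positive multiplicities, $\operatorname{supp}(X\cdot Y)=\{\omega\in N_{\mathbb R}:\operatorname{supp}(\operatorname{link}_\omega X)-\operatorname{supp}(\operatorname{link}_\omega Y)=N_{\mathbb R}\}$, where $S-T=\{s-t:s\in S,t\in T\}$. Limit: $\lim_{\varepsilon\to0}S_\varepsilon$ is the set of all $\omega\in N_{\mathbb R}$ such that for every $\delta>0$ the set $S_\varepsilon$ contains a point at distance less than $\delta$ from $\omega$ for all sufficiently small $\varepsilon>0$. *)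

theory Defs
  imports "HOL-Analysis.Analysis"
begin

text \<open>The lattice \<open>N\<close> is taken to be the set of integer vectors in \<open>real ^ 'n\<close>, which is
  then \<open>N\<^sub>\<real>\<close>; \<open>Hom(N,\<int>)\<close> is identified with the integer vectors via the inner product.\<close>

definition lattice_vectors :: "(real ^ 'n) set" where
  "lattice_vectors = {x. \<forall>i. x $ i \<in> \<int>}"

definition rational_polyhedron :: "(real ^ 'n) set \<Rightarrow> bool" where
  "rational_polyhedron P \<longleftrightarrow>
     (\<exists>F. finite F \<and> P = \<Inter>F \<and>
          (\<forall>h\<in>F. \<exists>u c. u \<in> lattice_vectors \<and> h = {x. u \<bullet> x \<le> c}))"

text \<open>The maximal sublattice \<open>N\<^sub>\<sigma>\<close> parallel to the affine span of \<open>\<sigma>\<close>.\<close>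

definition parallel_lattice :: "(real ^ 'n) set \<Rightarrow> (real ^ 'n) set" where
  "parallel_lattice \<sigma> =
     lattice_vectors \<inter> {x - y |x y. x \<in> affine hull \<sigma> \<and> y \<in> affine hull \<sigma>}"

text \<open>\<open>cells\<close> contains the cells of all dimensions; only the values of \<open>mult\<close> on facets are
  meaningful.\<close>

record 'a weighted_complex =
  cells :: "'a set set"
  mult :: "'a set \<Rightarrow> rat"

text \<open>The empty set is never a cell, although \<open>face_of\<close> counts it as a face of every
  convex set. In particular a \<open>0\<close>-dimensional complex has no ridges.\<close>

definition polyhedral_complex :: "(real ^ 'n) set set \<Rightarrow> bool" where
  "polyhedral_complex C \<longleftrightarrow>
     finite C \<and>
     (\<forall>\<sigma>\<in>C. rational_polyhedron \<sigma> \<and> \<sigma> \<noteq> {}) \<and>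
     (\<forall>\<sigma>\<in>C. \<forall>\<tau>. \<tau> face_of \<sigma> \<and> \<tau> \<noteq> {} \<longrightarrow> \<tau> \<in> C) \<and>
     (\<forall>\<sigma>\<in>C. \<forall>\<tau>\<in>C. (\<sigma> \<inter> \<tau>) face_of \<sigma> \<and> (\<sigma> \<inter> \<tau>) face_of \<tau>)"

definition facets :: "'a weighted_complex \<Rightarrow> 'a set set" where
  "facets X = {\<sigma> \<in> cells X. \<forall>\<sigma>'\<in>cells X. \<sigma> \<subseteq> \<sigma>' \<longrightarrow> \<sigma>' = \<sigma>}"

definition pure_dim :: "nat \<Rightarrow> (real ^ 'n) weighted_complex \<Rightarrow> bool" where
  "pure_dim k X \<longleftrightarrow> (\<forall>\<sigma>\<in>facets X. aff_dim \<sigma> = int k)"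

definition ridges :: "nat \<Rightarrow> (real ^ 'n) weighted_complex \<Rightarrow> (real ^ 'n) set set" where
  "ridges k X = {\<tau> \<in> cells X. aff_dim \<tau> = int k - 1}"

definition supp :: "'a weighted_complex \<Rightarrow> 'a set" where
  "supp X = \<Union>{\<sigma> \<in> facets X. mult X \<sigma> \<noteq> 0}"

definition link_cell :: "real ^ 'n \<Rightarrow> (real ^ 'n) set \<Rightarrow> (real ^ 'n) set" where
  "link_cell \<omega> \<sigma> = {u. \<forall>\<^sub>F \<epsilon> in at_right 0. \<omega> + \<epsilon> *\<^sub>R u \<in> \<sigma>}"

text \<open>In a polyhedral complex, distinct cells containing \<open>\<omega>\<close> have distinct links, so the
  \<open>THE\<close> below selects the unique cell from which a cell of the link inherits its multiplicity.\<close>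

definition link :: "real ^ 'n \<Rightarrow> (real ^ 'n) weighted_complex \<Rightarrow> (real ^ 'n) weighted_complex" where
  "link \<omega> X =
     \<lparr>cells = (if \<omega> \<in> supp X then {link_cell \<omega> \<sigma> |\<sigma>. \<sigma> \<in> cells X \<and> \<omega> \<in> \<sigma>} else {}),
      mult = (\<lambda>\<rho>. mult X (THE \<sigma>. \<sigma> \<in> cells X \<and> \<omega> \<in> \<sigma> \<and> link_cell \<omega> \<sigma> = \<rho>))\<rparr>"

text \<open>\<open>primitive_normal \<tau> \<sigma> v\<close>: \<open>v\<close> is an admissible choice of \<open>v\<^bsub>\<sigma>/\<tau>\<^esub>\<close>
  (unique modulo \<open>N\<^sub>\<tau>\<close>).\<close>

definition primitive_normal :: "(real ^ 'n) set \<Rightarrow> (real ^ 'n) set \<Rightarrow> real ^ 'n \<Rightarrow> bool" where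
  "primitive_normal \<tau> \<sigma> v \<longleftrightarrow>
     v \<in> lattice_vectors \<and>
     (\<exists>\<omega>\<in>rel_interior \<tau>. v \<in> link_cell \<omega> \<sigma>) \<and>
     parallel_lattice \<sigma> = {w + of_int m *\<^sub>R v |w m. w \<in> parallel_lattice \<tau>}"

definition rat_span :: "(real ^ 'n) set \<Rightarrow> (real ^ 'n) set" where
  "rat_span = module.span (\<lambda>(q::rat) x. of_rat q *\<^sub>R x)"

lemma vector_space_rat: "vector_space (\<lambda>(q::rat) (x::real ^ 'n). of_rat q *\<^sub>R x)"
  by unfold_locales (simp_all add: algebra_simps of_rat_add of_rat_mult)

definition balanced :: "nat \<Rightarrow> (real ^ 'n) weighted_complex \<Rightarrow> bool" where
  "balanced k X \<longleftrightarrow>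
     (\<forall>\<tau>\<in>ridges k X. \<exists>v.
        (\<forall>\<sigma>\<in>facets X. \<tau> \<subseteq> \<sigma> \<longrightarrow> primitive_normal \<tau> \<sigma> (v \<sigma>)) \<and>
        (\<Sum>\<sigma>\<in>{\<sigma> \<in> facets X. \<tau> \<subseteq> \<sigma>}. of_rat (mult X \<sigma>) *\<^sub>R v \<sigma>)
          \<in> rat_span (parallel_lattice \<tau>))"

text \<open>A weighted complex representing a tropical \<open>k\<close>-cycle. Passing to a refinement carrying
  equal multiplicities changes neither \<open>supp\<close> nor the supports of the links.\<close>

definition tropical_cycle :: "nat \<Rightarrow> (real ^ 'n) weighted_complex \<Rightarrow> bool" where
  "tropical_cycle k X \<longleftrightarrow> polyhedral_complex (cells X) \<and> pure_dim k X \<and> balanced k X"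

definition positive_multiplicities :: "'a weighted_complex \<Rightarrow> bool" where
  "positive_multiplicities X \<longleftrightarrow> (\<forall>\<sigma>\<in>facets X. mult X \<sigma> > 0)"

text \<open>The support of the stable intersection \<open>X \<cdot> Y\<close> of cycles with positive
  multiplicities.\<close>

definition stable_intersection_supp ::
  "(real ^ 'n) weighted_complex \<Rightarrow> (real ^ 'n) weighted_complex \<Rightarrow> (real ^ 'n) set" where
  "stable_intersection_supp X Y =
     {\<omega>. {s - t |s t. s \<in> supp (link \<omega> X) \<and> t \<in> supp (link \<omega> Y)} = UNIV}"

definition limit_set :: "(real \<Rightarrow> (real ^ 'n) set) \<Rightarrow> (real ^ 'n) set" where
  "limit_set S = {\<omega>. \<forall>\<delta>>0. \<forall>\<^sub>F \<epsilon> in at_right 0. \<exists>x\<in>S \<epsilon>. dist x \<omega> < \<delta>}"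

end

theory Submission imports Defs begin

text \<open>For every \<open>v\<close>, a point \<open>\<omega>\<close> lies in the limit set iff \<open>v \<in> A - B\<close>, where \<open>A\<close> and \<open>B\<close> are
  the supports of the links of \<open>X\<close> and \<open>Y\<close> at \<open>\<omega>\<close>. If \<open>v\<close> avoids the finitely many proper subspaces
  among the sums of the spaces parallel to a facet of \<open>X\<close> and a facet of \<open>Y\<close>, then \<open>v \<in> A - B\<close> forces
  some cell of the fan \<open>A \<times> B\<close> to map onto a full-dimensional set under \<open>\<phi>(a, b) = a - b\<close>, and it
  remains to see that \<open>\<phi>\<close> is then surjective on the whole fan.

  This holds for every linear map \<open>\<phi>\<close> and every balanced fan with positive weights. If \<open>\<phi>\<close> is
  surjective on the span \<open>D\<close> of some cell, it factors through a linear projection \<open>\<Psi>\<close> onto \<open>D\<close>,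
  so let \<open>\<phi> = \<Psi>\<close>. Join the target point \<open>w\<close> to a point \<open>w\<^sub>0\<close> in the image of
  this cell by a segment that avoids the images of all cells of codimension at least 2 (except possibly
  at \<open>w\<close>) and is not parallel to the image of a ridge. The points of the segment covered by cells on whose span
  \<open>\<Psi>\<close> is bijective form a compact set. At its last point before \<open>w\<close>, a preimage in the interior of a
  cell can be moved on, and for a preimage in a ridge balancing with positive weights provides an adjacent cell
  into which it can be moved on; so the last point is \<open>w\<close>.\<close>

section \<open>Linear images of balanced fans\<close>

text \<open>\<^const>\<open>link_cell\<close> over an arbitrary vector space, so that it applies to the product of two fans.\<close>

definition feasible_directions :: "'a::real_vector set \<Rightarrow> 'a \<Rightarrow> 'a set" where
  "feasible_directions C p = {u. \<forall>\<^sub>F \<epsilon> in at_right (0::real). p + \<epsilon> *\<^sub>R u \<in> C}"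

text \<open>The fan near a point \<open>p\<close> of a codimension-one cone with linear span
  \<open>T\<close>: \<open>J\<close> collects the cells around it, \<open>v j\<close> points from
  \<open>T\<close> into the cell \<open>j\<close>, and the positive real weights \<open>m j\<close>
  balance these normals modulo \<open>T\<close>. The feasibility clause makes the half of
  \<open>D j\<close> on the side of \<open>v j\<close> feasible at \<open>p\<close>.\<close>

definition linear_star ::
  "'i set \<Rightarrow> ('i \<Rightarrow> 'a::euclidean_space set) \<Rightarrow> ('i \<Rightarrow> 'a set) \<Rightarrow> 'a \<Rightarrow> 'a set \<Rightarrow> 'i set \<Rightarrow> bool" where
  "linear_star I D C p T J \<longleftrightarrow> p \<in> T \<and> J \<subseteq> I \<and> finite J \<and>
     (\<exists>v m. (\<forall>j\<in>J. 0 < m j \<and> D j = {x + c *\<^sub>R v j |x c. x \<in> T} \<and>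
               (\<forall>x\<in>T. \<forall>c\<ge>0. x + c *\<^sub>R v j \<in> feasible_directions (C j) p)) \<and>
            (\<Sum>j\<in>J. m j *\<^sub>R v j) \<in> T)"

text \<open>In the predicate below, the ridges enter only through the linear spaces \<open>\<T>\<close> parallel to them, and all smaller
  cells only through subspaces \<open>\<S>\<close> containing them.\<close>

definition balanced_fan ::
  "nat \<Rightarrow> 'i set \<Rightarrow> ('i \<Rightarrow> 'a::euclidean_space set) \<Rightarrow> ('i \<Rightarrow> 'a set) \<Rightarrow> 'a set set \<Rightarrow> 'a set set \<Rightarrow> bool" where
  "balanced_fan K I D C \<T> \<S> \<longleftrightarrow>
     (\<forall>i\<in>I. subspace (D i) \<and> dim (D i) = K \<and> C i \<subseteq> D i \<and> closed (C i) \<and>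
            (\<exists>p\<in>C i. D i \<subseteq> feasible_directions (C i) p)) \<and>
     finite I \<and> finite \<T> \<and> finite \<S> \<and>
     (\<forall>T\<in>\<T>. subspace T \<and> dim T + 1 \<le> K) \<and> (\<forall>S\<in>\<S>. subspace S \<and> dim S + 2 \<le> K) \<and>
     (\<forall>i\<in>I. \<forall>p\<in>C i. D i \<subseteq> feasible_directions (C i) p \<or>
        (\<exists>T\<in>\<T>. \<exists>J. i \<in> J \<and> linear_star I D C p T J) \<or> (\<exists>S\<in>\<S>. p \<in> S))"

section \<open>Points and directions off finitely many subspaces\<close>

lemma eventually_at_right_notin_finite:
  assumes "finite (A :: real set)"
  shows "\<forall>\<^sub>F \<epsilon> in at_right 0. \<epsilon> \<notin> A"
proof -
  have "finite (A - {0})" using assms by simp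
  then have "closed (A - {0})" by (rule finite_imp_closed)
  then have "\<forall>\<^sub>F \<epsilon> in nhds 0. \<epsilon> \<in> - (A - {0})"
    by (intro eventually_nhds_in_open open_Compl) auto
  then have "\<forall>\<^sub>F \<epsilon> in at_right 0. \<epsilon> \<in> - (A - {0})"
    unfolding at_within_def by (rule filter_leD[OF inf_le1])
  moreover have "\<forall>\<^sub>F \<epsilon> in at_right (0::real). \<epsilon> > 0"
    by (rule eventually_at_right_less)
  ultimately show ?thesis by eventually_elim auto
qed

text \<open>Two parameters whose points lie in \<open>U\<close> would put a nonzero multiple of
  \<open>e\<close> into \<open>U\<close>. Hence the line meets \<open>U\<close> at most once, and
  small positive parameters miss it.\<close>

lemma eventually_notin_subspace:
  assumes U: "subspace U" and e: "e \<notin> U"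
  shows "\<forall>\<^sub>F \<epsilon> in at_right (0::real). x + \<epsilon> *\<^sub>R e \<notin> U"
proof -
  have "a = b" if "x + a *\<^sub>R e \<in> U" "x + b *\<^sub>R e \<in> U" for a b :: real
  proof (rule ccontr)
    assume "a \<noteq> b"
    have "(a - b) *\<^sub>R e \<in> U" using subspace_diff[OF U that] by (simp add: algebra_simps)
    then have "inverse (a - b) *\<^sub>R (a - b) *\<^sub>R e \<in> U" by (rule subspace_scale[OF U])
    then show False using \<open>a \<noteq> b\<close> e by simp
  qed
  then have "finite {a. x + a *\<^sub>R e \<in> U}"
    by (metis (no_types, lifting) finite.emptyI finite_insert finite_subset insertCI mem_Collect_eq subsetI)
  from eventually_at_right_notin_finite[OF this] show ?thesis by simp
qed

text \<open>Induction on the number of subspaces. If the vector \<open>e\<close> found so far lies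
  in the new \<open>U\<close>, add a large multiple of it to some \<open>d\<close> in
  \<open>D\<close> outside \<open>U\<close>: modulo \<open>U\<close> this is still \<open>d\<close>,
  and the large multiple of \<open>e\<close> keeps it out of the older subspaces.\<close>

lemma avoid_finitely_many_subspaces:
  fixes D :: "'a::real_vector set"
  assumes "finite \<U>" "subspace D" "\<And>U. U \<in> \<U> \<Longrightarrow> subspace U \<and> \<not> D \<subseteq> U"
  obtains e where "e \<in> D" "\<And>U. U \<in> \<U> \<Longrightarrow> e \<notin> U"
proof -
  have "\<exists>e\<in>D. \<forall>U\<in>\<U>. e \<notin> U" using assms(1,3)
  proof (induction \<U>)
    case empty
    then show ?case using subspace_0[OF assms(2)] by blast
  next
    case (insert U \<U>)
    then obtain e where e: "e \<in> D" "\<forall>U\<in>\<U>. e \<notin> U" by blast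
    obtain d where d: "d \<in> D" "d \<notin> U" using insert.prems by blast
    show ?case
    proof (cases "e \<in> U")
      case False
      then show ?thesis using e by blast
    next
      case True
      have "\<forall>\<^sub>F \<epsilon> in at_right (0::real). \<forall>V\<in>\<U>. d + (1/\<epsilon>) *\<^sub>R e \<notin> V"
      proof (intro eventually_ball_finite \<open>finite \<U>\<close> ballI)
        fix V assume V: "V \<in> \<U>"
        then have sV: "subspace V" using insert.prems by blast
        have "e \<notin> V" using V e by blast
        from eventually_notin_subspace[OF sV] show "\<forall>\<^sub>F \<epsilon> in at_right (0::real). d + (1/\<epsilon>) *\<^sub>R e \<notin> V"
        proof (cases "d \<in> V")
          case False
          have "\<forall>\<^sub>F \<epsilon> in at_right (0::real). e + \<epsilon> *\<^sub>R d \<notin> V \<and> \<epsilon> > 0"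
            by (intro eventually_conj eventually_notin_subspace sV False eventually_at_right_less)
          then show ?thesis
          proof eventually_elim
            case (elim \<epsilon>)
            have "\<epsilon> *\<^sub>R (d + (1/\<epsilon>) *\<^sub>R e) = e + \<epsilon> *\<^sub>R d" using elim by (simp add: algebra_simps)
            then show ?case using elim subspace_scale[OF sV] by metis
          qed
        next
          case True
          have "\<forall>\<^sub>F \<epsilon> in at_right (0::real). \<epsilon> > 0" by (rule eventually_at_right_less)
          then show ?thesis
          proof eventually_elim
            case (elim \<epsilon>)
            show ?case
            proof
              assume "d + (1/\<epsilon>) *\<^sub>R e \<in> V"
              then have "\<epsilon> *\<^sub>R (d + (1/\<epsilon>) *\<^sub>R e - d) \<in> V"
                by (intro subspace_scale subspace_diff sV True)
              then show False using elim \<open>e \<notin> V\<close> by simp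
            qed
          qed
        qed
      qed
      then obtain \<epsilon> :: real where \<epsilon>: "\<forall>V\<in>\<U>. d + (1/\<epsilon>) *\<^sub>R e \<notin> V"
        using eventually_happens' trivial_limit_at_right_real by blast
      have sU: "subspace U" using insert.prems by blast
      have "d + (1/\<epsilon>) *\<^sub>R e \<notin> U"
        using d True subspace_scale[OF sU] subspace_diff[OF sU] by (metis add_diff_cancel_right')
      moreover have "d + (1/\<epsilon>) *\<^sub>R e \<in> D"
        by (intro subspace_add subspace_scale assms d e)
      ultimately show ?thesis using \<epsilon> by blast
    qed
  qed
  then show ?thesis using that by blast
qed

lemma feasible_directions_scale:
  assumes "u \<in> feasible_directions C p" "c > 0"
  shows "c *\<^sub>R u \<in> feasible_directions C p"
proof -
  have "filterlim (\<lambda>\<epsilon>. \<epsilon> * c) (at_right 0) (at_right (0::real))"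
    using assms(2) by (auto simp: filterlim_at eventually_at_filter intro!: tendsto_eq_intros eventually_mono[OF eventually_at_right_less])
  from filterlim_iff[THEN iffD1, rule_format, OF this] assms(1) show ?thesis
    by (auto simp: feasible_directions_def)
qed

text \<open>Projecting onto \<open>D r\<close> makes the target space \<open>K\<close>-dimensional,
  so the image of a space in \<open>\<T>\<close> is a proper subspace of it, and so is the span of
  \<open>w\<close> and the image of a space in \<open>\<S>\<close>. A generic segment towards
  \<open>w\<close> is therefore available, and its covered part cannot end before
  \<open>w\<close>.\<close>

lemma balanced_fan_projection_surj:
  assumes fan: "balanced_fan K I D C \<T> \<S>" and r: "r \<in> I"
    and lin: "linear \<Psi>" and range: "range \<Psi> \<subseteq> D r" and id: "\<And>x. x \<in> D r \<Longrightarrow> \<Psi> x = x"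
    and w: "w \<in> D r"
  shows "\<exists>i\<in>I. w \<in> \<Psi> ` C i"
proof -
  interpret \<Psi>: linear \<Psi> by (rule lin)
  have cell: "subspace (D i)" "dim (D i) = K" "C i \<subseteq> D i" "closed (C i)" if "i \<in> I" for i
    using fan that by (auto simp: balanced_fan_def)
  have fin: "finite I" "finite \<T>" "finite \<S>" using fan by (auto simp: balanced_fan_def)
  have T: "subspace T" "dim T + 1 \<le> K" if "T \<in> \<T>" for T using fan that by (auto simp: balanced_fan_def)
  have S: "subspace S" "dim S + 2 \<le> K" if "S \<in> \<S>" for S using fan that by (auto simp: balanced_fan_def)
  obtain c0 where c0: "c0 \<in> C r" "D r \<subseteq> feasible_directions (C r) c0"
    using fan r by (auto simp: balanced_fan_def)
  \<comment> \<open>A direction outside the first kind of subspace is not parallel to the image of a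
    ridge. A segment that ends at \<open>w\<close> and has a direction outside the second kind meets
    no image of a member of \<open>\<S>\<close>, except possibly at \<open>w\<close>.\<close>
  define \<U> where "\<U> = (\<lambda>T. \<Psi> ` T) ` \<T> \<union> (\<lambda>S. span (insert w (\<Psi> ` S))) ` \<S>"
  have \<U>: "subspace U \<and> \<not> D r \<subseteq> U" if "U \<in> \<U>" for U
  proof -
    have "subspace U" using that T S by (auto simp: \<U>_def intro!: linear_subspace_image[OF lin])
    moreover have "dim U < K"
    proof -
      have "dim (\<Psi> ` T) < K" if "T \<in> \<T>" for T
        using dim_image_le[OF lin, of T] T[OF that] by linarith
      moreover have "dim (span (insert w (\<Psi> ` S))) < K" if "S \<in> \<S>" for S
        using dim_image_le[OF lin, of S] S[OF that] by (auto simp: dim_insert)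
      ultimately show ?thesis using that by (auto simp: \<U>_def)
    qed
    ultimately show ?thesis using dim_subset[of "D r" U] cell[OF r] by auto
  qed
  have "finite \<U>" using fin by (simp add: \<U>_def)
  then obtain e where e: "e \<in> D r" "\<And>U. U \<in> \<U> \<Longrightarrow> e \<notin> U"
    using avoid_finitely_many_subspaces[OF _ cell(1)[OF r] \<U>] by blast
  have "\<forall>\<^sub>F \<epsilon> in at_right (0::real). \<forall>U\<in>\<U>. (c0 - w) + \<epsilon> *\<^sub>R e \<notin> U"
    using e \<U> by (intro eventually_ball_finite \<open>finite \<U>\<close> ballI eventually_notin_subspace) auto
  moreover have "\<forall>\<^sub>F \<epsilon> in at_right 0. c0 + \<epsilon> *\<^sub>R e \<in> C r"
    using e c0 by (auto simp: feasible_directions_def)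
  ultimately have "\<forall>\<^sub>F \<epsilon> in at_right (0::real). (\<forall>U\<in>\<U>. (c0 - w) + \<epsilon> *\<^sub>R e \<notin> U) \<and> c0 + \<epsilon> *\<^sub>R e \<in> C r"
    by (rule eventually_conj)
  then obtain \<epsilon> :: real where \<epsilon>: "\<forall>U\<in>\<U>. (c0 - w) + \<epsilon> *\<^sub>R e \<notin> U" "c0 + \<epsilon> *\<^sub>R e \<in> C r"
    using eventually_happens' trivial_limit_at_right_real by blast
  \<comment> \<open>The shift along \<open>e\<close> makes the direction towards \<open>w\<close>
    generic and is small enough to keep \<open>w0\<close> in the cell \<open>r\<close>. As
    \<open>\<Psi>\<close> fixes this cell pointwise, \<open>w0\<close> is its own preimage.\<close>
  define w0 where "w0 = c0 + \<epsilon> *\<^sub>R e"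
  define d where "d = w - w0"
  have w0: "w0 \<in> C r" "w0 \<in> D r" using \<epsilon>(2) cell[OF r] by (auto simp: w0_def)
  have dD: "d \<in> D r" unfolding d_def by (intro subspace_diff cell r w w0)
  have dU: "d \<notin> U" if "U \<in> \<U>" for U
  proof
    assume "d \<in> U"
    then have "- d \<in> U" using \<U>[OF that] subspace_neg by blast
    then show False using \<epsilon>(1) that by (auto simp: d_def w0_def algebra_simps)
  qed
  \<comment> \<open>Only surjectivity onto \<open>D r\<close> is asked for. As all spans have
    dimension \<open>K\<close>, \<open>\<Psi>\<close> is then bijective from \<open>D i\<close> to
    \<open>D r\<close>, and \<open>g i\<close> below is its two-sided inverse.\<close>
  define good where "good i \<longleftrightarrow> i \<in> I \<and> D r \<subseteq> \<Psi> ` D i" for i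
  have good_o: "good r" using r id by (force simp: good_def)
  have "\<exists>g. good i \<longrightarrow> linear g \<and> (\<forall>y\<in>D r. g y \<in> D i \<and> \<Psi> (g y) = y) \<and> (\<forall>x\<in>D i. g (\<Psi> x) = x)" for i
  proof (cases "good i")
    case True
    have i: "i \<in> I" "D r \<subseteq> \<Psi> ` D i" using True by (auto simp: good_def)
    obtain g where g: "g ` UNIV \<subseteq> D i" "linear g" "\<forall>y\<in>\<Psi> ` D i. \<Psi> (g y) = y"
      using linear_exists_right_inverse_on[OF lin cell(1)[OF i(1)]] by blast
    interpret g: linear g by (rule g)
    have inv: "\<Psi> (g y) = y" if "y \<in> D r" for y using g i that by blast
    have "dim (g ` D r) = dim (D r)"
    proof (rule dim_image_eq[OF g(2)])
      show "inj_on g (span (D r))"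
        using inv by (intro inj_on_inverseI[of _ \<Psi>]) (simp add: span_eq_iff[THEN iffD2, OF cell(1)[OF r]])
    qed
    then have "g ` D r = D i"
      using g(1) by (intro subspace_dim_equal linear_subspace_image[OF g(2)] cell r i) (auto simp: cell r i)
    then have "g (\<Psi> x) = x" if "x \<in> D i" for x using inv that by force
    moreover have "g y \<in> D i \<and> \<Psi> (g y) = y" if "y \<in> D r" for y
      using g(1) inv[OF that] by blast
    ultimately show ?thesis using g(2) by blast
  qed simp
  then obtain g where "\<forall>i. good i \<longrightarrow> linear (g i) \<and> (\<forall>y\<in>D r. g i y \<in> D i \<and> \<Psi> (g i y) = y) \<and>
      (\<forall>x\<in>D i. g i (\<Psi> x) = x)"
    using choice[where Q = "\<lambda>i g. good i \<longrightarrow> linear g \<and> (\<forall>y\<in>D r. g y \<in> D i \<and> \<Psi> (g y) = y) \<and>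
      (\<forall>x\<in>D i. g (\<Psi> x) = x)"] by blast
  then have g: "\<And>i. good i \<Longrightarrow> linear (g i)"
    "\<And>i y. good i \<Longrightarrow> y \<in> D r \<Longrightarrow> g i y \<in> D i" "\<And>i y. good i \<Longrightarrow> y \<in> D r \<Longrightarrow> \<Psi> (g i y) = y"
    "\<And>i x. good i \<Longrightarrow> x \<in> D i \<Longrightarrow> g i (\<Psi> x) = x" by blast+
  \<comment> \<open>The parameters whose point on the segment is covered by a good cell. Pulling
    \<open>C i\<close> back along the linear map \<open>g i\<close> shows at once that this set is
    compact.\<close>
  define A where "A = (\<Union>i\<in>{i. good i}. {0..1} \<inter> (\<lambda>t. g i (w0 + t *\<^sub>R d)) -` C i)"
  have line: "w0 + t *\<^sub>R d \<in> D r" for t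
    by (intro subspace_add subspace_scale cell r w0 dD)
  have A_iff: "t \<in> A \<longleftrightarrow> 0 \<le> t \<and> t \<le> 1 \<and> (\<exists>i x. good i \<and> x \<in> C i \<and> \<Psi> x = w0 + t *\<^sub>R d)" for t
  proof -
    have "g i (w0 + t *\<^sub>R d) \<in> C i \<longleftrightarrow> (\<exists>x\<in>C i. \<Psi> x = w0 + t *\<^sub>R d)" if "good i" for i
      using g(3)[OF that line] g(4)[OF that] cell(3)[of i] that by (force simp: good_def)
    then show ?thesis by (auto simp: A_def)
  qed
  have "compact A" unfolding A_def
  proof (intro compact_UN compact_Int_closed compact_Icc closed_vimage)
    show "finite {i. good i}" using fin(1) by (rule rev_finite_subset) (auto simp: good_def)
  next
    fix i assume "i \<in> {i. good i}"
    then have i: "good i" by simp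
    then show "closed (C i)" by (simp add: good_def cell)
    show "continuous_on UNIV (\<lambda>t. g i (w0 + t *\<^sub>R d))"
      by (rule linear_continuous_on_compose[OF _ g(1)[OF i]]) (intro continuous_intros)
  qed
  moreover have "0 \<in> A" using w0 good_o id by (auto simp: A_iff)
  ultimately obtain t where t: "t \<in> A" "\<And>s. s \<in> A \<Longrightarrow> s \<le> t"
    using compact_attains_sup[of A] by blast
  then obtain i x where ix: "0 \<le> t" "t \<le> 1" "good i" "x \<in> C i" "\<Psi> x = w0 + t *\<^sub>R d"
    by (auto simp: A_iff)
  \<comment> \<open>Maximality of \<open>t\<close>: a direction over \<open>d\<close> that is
    feasible in a good cell would cover slightly larger parameters.\<close>
  have stuck: False
    if "t < 1" and j: "good j" and y: "y \<in> feasible_directions (C j) x" "\<Psi> y = d" for j y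
  proof -
    have "\<forall>\<^sub>F \<epsilon> in at_right 0. x + \<epsilon> *\<^sub>R y \<in> C j \<and> 0 < \<epsilon> \<and> \<epsilon> < 1 - t"
      using y that(1) by (auto simp: feasible_directions_def eventually_conj_iff
          eventually_at_right_less intro: eventually_at_rightI[of 0 "1-t"])
    then obtain \<epsilon> where \<epsilon>: "x + \<epsilon> *\<^sub>R y \<in> C j" "0 < \<epsilon>" "\<epsilon> < 1 - t"
      using eventually_happens' trivial_limit_at_right_real by blast
    have "\<Psi> (x + \<epsilon> *\<^sub>R y) = w0 + (t + \<epsilon>) *\<^sub>R d"
      using y ix by (simp add: \<Psi>.add \<Psi>.scale algebra_simps)
    then have "t + \<epsilon> \<in> A" using \<epsilon> ix j by (auto simp: A_iff)
    then show False using t(2) \<epsilon> by fastforce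
  qed
  have "t = 1"
  proof (rule ccontr)
    assume "t \<noteq> 1"
    then have t1: "t < 1" using ix by simp
    have i: "i \<in> I" "D r \<subseteq> \<Psi> ` D i" using ix by (auto simp: good_def)
    consider "D i \<subseteq> feasible_directions (C i) x"
      | T J where "T \<in> \<T>" "i \<in> J" "linear_star I D C x T J"
      | S where "S \<in> \<S>" "x \<in> S"
      using fan i(1) ix(4) unfolding balanced_fan_def by blast
    then show False
    proof cases
      case 1
      then show ?thesis using stuck[OF t1 ix(3), of "g i d"] g ix dD by blast
    next
      case (2 T J)
      from 2(3) obtain v m where J: "J \<subseteq> I" "finite J"
        and vm: "\<forall>j\<in>J. 0 < m j \<and> D j = {x + c *\<^sub>R v j |x c. x \<in> T} \<and>
               (\<forall>z\<in>T. \<forall>c\<ge>0. z + c *\<^sub>R v j \<in> feasible_directions (C j) x)"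
        and bal: "(\<Sum>j\<in>J. m j *\<^sub>R v j) \<in> T"
        unfolding linear_star_def by (elim conjE exE) (rule that)
      have m: "\<And>j. j \<in> J \<Longrightarrow> 0 < m j" and Dj: "\<And>j. j \<in> J \<Longrightarrow> D j = {x + c *\<^sub>R v j |x c. x \<in> T}"
        and feas: "\<And>j z c. j \<in> J \<Longrightarrow> z \<in> T \<Longrightarrow> 0 \<le> c \<Longrightarrow> z + c *\<^sub>R v j \<in> feasible_directions (C j) x"
        using vm by auto
      have subT: "subspace (\<Psi> ` T)" using T 2 by (intro linear_subspace_image[OF lin]) auto
      have dT: "d \<notin> \<Psi> ` T" using 2 by (intro dU) (auto simp: \<U>_def)
      have rep: "\<exists>z c. z \<in> T \<and> a = \<Psi> (z + c *\<^sub>R v i)" if "a \<in> D r" for a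
      proof -
        have "a \<in> \<Psi> ` D i" using i(2) that by blast
        then show ?thesis unfolding Dj[OF 2(2)] by blast
      qed
      obtain z c where zc: "z \<in> T" "d = \<Psi> (z + c *\<^sub>R v i)"
        using rep[OF dD] by blast
      \<comment> \<open>So \<open>d\<close> spans \<open>D r\<close> modulo the image of
        \<open>T\<close>, and each \<open>\<Psi> (v j)\<close> is a multiple of \<open>d\<close>
        modulo that image.\<close>
      have "c \<noteq> 0" using dT zc by auto
      have "\<exists>e. \<Psi> (v j) - e *\<^sub>R d \<in> \<Psi> ` T" if "j \<in> J" for j
      proof -
        have "\<Psi> (v j) \<in> D r" using range by blast
        then obtain z' c' where z': "z' \<in> T" "\<Psi> (v j) = \<Psi> (z' + c' *\<^sub>R v i)"
          using rep by blast
        have "\<Psi> (v j) - (c'/c) *\<^sub>R d = \<Psi> z' - (c'/c) *\<^sub>R \<Psi> z"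
          using \<open>c \<noteq> 0\<close> by (simp add: zc(2) z'(2) \<Psi>.add \<Psi>.scale algebra_simps)
        also have "\<dots> \<in> \<Psi> ` T" using z' zc by (intro subspace_diff subspace_scale subT) auto
        finally show ?thesis by blast
      qed
      then obtain e where e: "\<And>j. j \<in> J \<Longrightarrow> \<Psi> (v j) - e j *\<^sub>R d \<in> \<Psi> ` T" by metis
      \<comment> \<open>\<open>e j\<close> is the speed along \<open>d\<close> of the image of \<open>v j\<close> modulo the image of the ridge.\<close>
      have "e j \<le> 0" if jJ: "j \<in> J" for j
      proof (rule ccontr)
        assume "\<not> e j \<le> 0"
        then have pos: "e j > 0" by simp
        obtain y where y: "y \<in> T" "\<Psi> (v j) - e j *\<^sub>R d = \<Psi> y" using e[OF jJ] by blast
        have d_eq: "d = \<Psi> ((- (1 / e j)) *\<^sub>R y + (1 / e j) *\<^sub>R v j)"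
        proof -
          have "\<Psi> (v j) = e j *\<^sub>R d + \<Psi> y" using y by (simp add: algebra_simps)
          then show ?thesis using pos by (simp only: \<Psi>.add \<Psi>.scale) (simp add: algebra_simps)
        qed
        \<comment> \<open>The image of \<open>D j\<close> contains \<open>d\<close> and the image of
          \<open>T\<close>, which together span \<open>D r\<close>, so \<open>j\<close> is good. By
          \<open>d_eq\<close>, \<open>d\<close> comes from a direction with a positive multiple of
          \<open>v j\<close>, which is feasible, against the maximality of \<open>t\<close>.\<close>
        have "D r \<subseteq> \<Psi> ` D j"
        proof
          fix a assume "a \<in> D r"
          then obtain z' c' where z': "z' \<in> T" "a = \<Psi> (z' + c' *\<^sub>R v i)"
            using rep by blast
          obtain y' where y': "y' \<in> T" "\<Psi> (v i) - e i *\<^sub>R d = \<Psi> y'" using e[OF 2(2)] by blast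
          have sD: "subspace (\<Psi> ` D j)" using J jJ cell by (intro linear_subspace_image[OF lin]) auto
          have TD: "T \<subseteq> D j"
          proof
            fix s assume "s \<in> T"
            then have "s + 0 *\<^sub>R v j \<in> D j" using Dj[OF jJ] by blast
            then show "s \<in> D j" by simp
          qed
          have mem: "(- (1 / e j)) *\<^sub>R y + (1 / e j) *\<^sub>R v j \<in> D j"
            using T(1)[OF 2(1)] y(1) unfolding Dj[OF jJ] by (blast intro: subspace_scale subspace_neg)
          have "d \<in> \<Psi> ` D j" by (subst d_eq, rule imageI, rule mem)
          moreover have "a = \<Psi> z' + c' *\<^sub>R (\<Psi> y' + e i *\<^sub>R d)"
            using z' y'(2)[symmetric] by (simp add: \<Psi>.add \<Psi>.scale)
          ultimately show "a \<in> \<Psi> ` D j"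
            using TD z' y' by (auto intro!: subspace_add[OF sD] subspace_scale[OF sD])
        qed
        then have "good j" using J jJ by (auto simp: good_def)
        moreover have "(- (1 / e j)) *\<^sub>R y + (1 / e j) *\<^sub>R v j \<in> feasible_directions (C j) x"
          using pos y(1) T(1)[OF 2(1)] by (intro feas jJ subspace_scale) auto
        ultimately show False using stuck[OF t1] d_eq by metis
      qed
      \<comment> \<open>Apply \<open>\<Psi>\<close> to the balancing relation and reduce modulo the
        image of \<open>T\<close>, where \<open>d\<close> is nonzero.\<close>
      moreover have "(\<Sum>j\<in>J. m j * e j) = 0"
      proof -
        have "(\<Sum>j\<in>J. m j *\<^sub>R (\<Psi> (v j) - e j *\<^sub>R d)) \<in> \<Psi> ` T"
          by (intro subspace_sum subspace_scale subT e)
        moreover have "(\<Sum>j\<in>J. m j *\<^sub>R (\<Psi> (v j) - e j *\<^sub>R d)) =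
            \<Psi> (\<Sum>j\<in>J. m j *\<^sub>R v j) - (\<Sum>j\<in>J. m j * e j) *\<^sub>R d"
          by (simp add: \<Psi>.sum \<Psi>.scale scaleR_diff_right sum_subtractf scaleR_sum_left)
        ultimately have "\<Psi> (\<Sum>j\<in>J. m j *\<^sub>R v j) - (\<Sum>j\<in>J. m j * e j) *\<^sub>R d \<in> \<Psi> ` T" by simp
        from subspace_diff[OF subT imageI[OF bal] this]
        have "(\<Sum>j\<in>J. m j * e j) *\<^sub>R d \<in> \<Psi> ` T" by simp
        from subspace_scale[OF subT this, of "inverse (\<Sum>j\<in>J. m j * e j)"] dT
        show ?thesis by (cases "(\<Sum>j\<in>J. m j * e j) = 0") auto
      qed
      \<comment> \<open>Nonpositive speeds with positive weights and weighted sum zero all vanish.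
        But \<open>e i = 0\<close> puts \<open>\<Psi> (v i)\<close>, and with it \<open>d\<close>,
        into the image of \<open>T\<close>.\<close>
      ultimately have "m i * e i = 0"
        using sum_nonneg_eq_0_iff[OF J(2), of "\<lambda>j. - (m j * e j)"] 2(2) m
        by (auto simp: sum_negf mult_nonneg_nonpos less_imp_le)
      then have "e i = 0" using m[OF 2(2)] by simp
      then have "\<Psi> (v i) \<in> \<Psi> ` T" using e[OF 2(2)] by simp
      then have "\<Psi> z + c *\<^sub>R \<Psi> (v i) \<in> \<Psi> ` T"
        using zc by (intro subspace_add subspace_scale subT) auto
      then show False using dT zc by (simp add: \<Psi>.add \<Psi>.scale)
    next
      case (3 S)
      have "w0 + t *\<^sub>R d \<in> \<Psi> ` S" using 3 ix by (metis imageI)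
      \<comment> \<open>The current point lies in the image of \<open>S\<close>. As
        \<open>t < 1\<close>, \<open>d\<close> is a combination of this point and \<open>w\<close>,
        which the choice of \<open>d\<close> excludes.\<close>
      moreover have "d = (1/(1-t)) *\<^sub>R (w - (w0 + t *\<^sub>R d))"
      proof -
        have "w - (w0 + t *\<^sub>R d) = (1-t) *\<^sub>R d" by (simp add: d_def algebra_simps)
        then show ?thesis using t1 by simp
      qed
      ultimately have "d \<in> span (insert w (\<Psi> ` S))"
        by (metis span_base span_diff span_scale insertI1 insertI2)
      then show False using dU[of "span (insert w (\<Psi> ` S))"] 3 by (auto simp: \<U>_def)
    qed
  qed
  then show ?thesis using ix by (auto simp: good_def d_def intro!: bexI[of _ i] rev_image_eqI[of x])
qed

text \<open>Since \<open>\<phi>\<close> maps \<open>D r\<close> onto the target, it factors through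
  a projection onto \<open>D r\<close>. It remains to cover a preimage of \<open>w\<close> in
  \<open>D r\<close> under that projection.\<close>

proposition balanced_fan_image_surj:
  fixes \<phi> :: "'a::euclidean_space \<Rightarrow> 'b::euclidean_space"
  assumes fan: "balanced_fan K I D C \<T> \<S>" and r: "r \<in> I"
    and \<phi>: "linear \<phi>" and surj: "\<phi> ` D r = UNIV"
  shows "\<exists>i\<in>I. w \<in> \<phi> ` C i"
proof -
  interpret \<phi>: linear \<phi> by (rule \<phi>)
  have sub: "subspace (D r)" using fan r by (auto simp: balanced_fan_def)
  obtain s where s: "s ` UNIV \<subseteq> D r" "linear s" "\<forall>y\<in>\<phi> ` D r. \<phi> (s y) = y"
    using linear_exists_right_inverse_on[OF \<phi> sub] by blast
  obtain \<pi> where \<pi>: "\<pi> ` UNIV \<subseteq> D r" "linear \<pi>" "\<forall>x\<in>D r. \<pi> (id x) = x"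
    using linear_exists_left_inverse_on[OF linear_id sub] by auto
  interpret s: linear s by (rule s)
  interpret \<pi>: linear \<pi> by (rule \<pi>)
  \<comment> \<open>The first summand lifts \<open>\<phi> x\<close> to \<open>D r\<close>. The
    correction lies in the kernel of \<open>\<phi>\<close> and makes \<open>\<Psi>\<close> the
    identity on \<open>D r\<close>.\<close>
  define \<Psi> where "\<Psi> x = s (\<phi> x) + (\<pi> x - s (\<phi> (\<pi> x)))" for x
  have \<phi>\<Psi>: "\<phi> (\<Psi> x) = \<phi> x" for x using s(3) surj by (simp add: \<Psi>_def \<phi>.add \<phi>.diff)
  have "linear \<Psi>" unfolding \<Psi>_def
    by (intro linear_compose_add linear_compose_sub \<pi> linear_compose[OF \<phi> s(2), unfolded o_def]
        linear_compose[OF \<pi>(2) linear_compose[OF \<phi> s(2)], unfolded o_def])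
  moreover have "range \<Psi> \<subseteq> D r"
    using s(1) \<pi>(1) by (auto simp: \<Psi>_def intro!: subspace_add subspace_diff sub)
  moreover have "\<Psi> x = x" if "x \<in> D r" for x using that \<pi> by (simp add: \<Psi>_def)
  moreover obtain z where "z \<in> D r" "\<phi> z = w" using surj by (metis UNIV_I imageE)
  ultimately obtain i where "i \<in> I" "z \<in> \<Psi> ` C i"
    using balanced_fan_projection_surj[OF fan r] by blast
  then show ?thesis using \<phi>\<Psi> \<open>\<phi> z = w\<close> by (metis image_iff)
qed

section \<open>Products of balanced fans\<close>

lemma feasible_directions_Times:
  assumes "u \<in> feasible_directions C p" "w \<in> feasible_directions B q"
  shows "(u, w) \<in> feasible_directions (C \<times> B) (p, q)"
  using assms by (auto simp: feasible_directions_def eventually_conj_iff)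

text \<open>An interior point \<open>q\<close> of the second factor contributes its whole span to
  the ridge space. The normals of the first factor are extended by \<open>0\<close> and keep their
  weights, so balancing is inherited.\<close>

lemma linear_star_Times_left:
  assumes star: "linear_star I D C p T M" and j: "j \<in> J" "subspace (E j)" and qE: "q \<in> E j"
    and q: "E j \<subseteq> feasible_directions (B j) q"
  shows "linear_star (I \<times> J) (\<lambda>(i, j). D i \<times> E j) (\<lambda>(i, j). C i \<times> B j) (p, q) (T \<times> E j) (M \<times> {j})"
proof -
  obtain v m where pT: "p \<in> T" and M: "M \<subseteq> I" "finite M"
    and vm: "\<forall>i\<in>M. 0 < m i \<and> D i = {x + c *\<^sub>R v i |x c. x \<in> T} \<and>
               (\<forall>z\<in>T. \<forall>c\<ge>0. z + c *\<^sub>R v i \<in> feasible_directions (C i) p)"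
    and bal: "(\<Sum>i\<in>M. m i *\<^sub>R v i) \<in> T"
    using star unfolding linear_star_def by (elim conjE exE) (rule that)
  define v' :: "'a \<times> 'c \<Rightarrow> 'b \<times> 'd" where "v' = (\<lambda>(i, _). (v i, 0))"
  define m' :: "'a \<times> 'c \<Rightarrow> real" where "m' = (\<lambda>(i, _). m i)"
  have "0 < m' (i, j) \<and> D i \<times> E j = {x + c *\<^sub>R v' (i, j) |x c. x \<in> T \<times> E j} \<and>
      (\<forall>z\<in>T \<times> E j. \<forall>c\<ge>0. z + c *\<^sub>R v' (i, j) \<in> feasible_directions (C i \<times> B j) (p, q))"
    if i: "i \<in> M" for i
  proof (intro conjI ballI allI impI)
    show "0 < m' (i, j)" using vm i by (simp add: m'_def)
    have "D i = {x + c *\<^sub>R v i |x c. x \<in> T}" using vm i by blast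
    then show "D i \<times> E j = {x + c *\<^sub>R v' (i, j) |x c. x \<in> T \<times> E j}"
      by (auto simp: v'_def)
    fix z c assume "z \<in> T \<times> E j" "(0::real) \<le> c"
    then show "z + c *\<^sub>R v' (i, j) \<in> feasible_directions (C i \<times> B j) (p, q)"
      using vm i q by (auto simp: v'_def intro!: feasible_directions_Times)
  qed
  moreover have "(\<Sum>x\<in>M \<times> {j}. m' x *\<^sub>R v' x) \<in> T \<times> E j"
  proof -
    have "M \<times> {j} = (\<lambda>i. (i, j)) ` M" by auto
    then have "(\<Sum>x\<in>M \<times> {j}. m' x *\<^sub>R v' x) = (\<Sum>i\<in>M. m' (i, j) *\<^sub>R v' (i, j))"
      by (simp add: sum.reindex inj_on_def)
    also have "\<dots> = (\<Sum>i\<in>M. m i *\<^sub>R v i, 0)"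
      by (rule prod_eqI) (simp_all add: fst_sum snd_sum m'_def v'_def)
    finally show ?thesis using bal j(2) by (simp add: subspace_0)
  qed
  ultimately show ?thesis unfolding linear_star_def
    using M j q pT qE by (intro conjI exI[of _ v'] exI[of _ m']) auto
qed

lemma linear_star_Times_right:
  assumes star: "linear_star J E B q T M" and i: "i \<in> I" "subspace (D i)" and pD: "p \<in> D i"
    and p: "D i \<subseteq> feasible_directions (C i) p"
  shows "linear_star (I \<times> J) (\<lambda>(i, j). D i \<times> E j) (\<lambda>(i, j). C i \<times> B j) (p, q) (D i \<times> T) ({i} \<times> M)"
proof -
  obtain v m where pT: "q \<in> T" and M: "M \<subseteq> J" "finite M"
    and vm: "\<forall>j\<in>M. 0 < m j \<and> E j = {x + c *\<^sub>R v j |x c. x \<in> T} \<and>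
               (\<forall>z\<in>T. \<forall>c\<ge>0. z + c *\<^sub>R v j \<in> feasible_directions (B j) q)"
    and bal: "(\<Sum>j\<in>M. m j *\<^sub>R v j) \<in> T"
    using star unfolding linear_star_def by (elim conjE exE) (rule that)
  define v' :: "'c \<times> 'a \<Rightarrow> 'd \<times> 'b" where "v' = (\<lambda>(_, j). (0, v j))"
  define m' :: "'c \<times> 'a \<Rightarrow> real" where "m' = (\<lambda>(_, j). m j)"
  have "0 < m' (i, j) \<and> D i \<times> E j = {x + c *\<^sub>R v' (i, j) |x c. x \<in> D i \<times> T} \<and>
      (\<forall>z\<in>D i \<times> T. \<forall>c\<ge>0. z + c *\<^sub>R v' (i, j) \<in> feasible_directions (C i \<times> B j) (p, q))"
    if j: "j \<in> M" for j
  proof (intro conjI ballI allI impI)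
    show "0 < m' (i, j)" using vm j by (simp add: m'_def)
    have "E j = {x + c *\<^sub>R v j |x c. x \<in> T}" using vm j by blast
    then show "D i \<times> E j = {x + c *\<^sub>R v' (i, j) |x c. x \<in> D i \<times> T}"
      by (auto simp: v'_def)
    fix z c assume "z \<in> D i \<times> T" "(0::real) \<le> c"
    then show "z + c *\<^sub>R v' (i, j) \<in> feasible_directions (C i \<times> B j) (p, q)"
      using vm j p by (auto simp: v'_def intro!: feasible_directions_Times)
  qed
  moreover have "(\<Sum>x\<in>{i} \<times> M. m' x *\<^sub>R v' x) \<in> D i \<times> T"
  proof -
    have "{i} \<times> M = (\<lambda>j. (i, j)) ` M" by auto
    then have "(\<Sum>x\<in>{i} \<times> M. m' x *\<^sub>R v' x) = (\<Sum>j\<in>M. m' (i, j) *\<^sub>R v' (i, j))"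
      by (simp add: sum.reindex inj_on_def)
    also have "\<dots> = (0, \<Sum>j\<in>M. m j *\<^sub>R v j)"
      by (rule prod_eqI) (simp_all add: fst_sum snd_sum m'_def v'_def)
    finally show ?thesis using bal i(2) by (simp add: subspace_0)
  qed
  ultimately show ?thesis unfolding linear_star_def
    using M i p pT pD by (intro conjI exI[of _ v'] exI[of _ m']) auto
qed

text \<open>A point of a product cell is interior if both components are, and lies on a product
  ridge if one is interior and the other on a ridge. Two ridge components, or one component in a
  smaller cell, leave codimension at least 2; such points are absorbed by
  \<open>\<V>\<close>.\<close>

lemma balanced_fan_Times:
  fixes D C :: "'i \<Rightarrow> 'a::euclidean_space set" and E B :: "'j \<Rightarrow> 'b::euclidean_space set"
  assumes X: "balanced_fan K I D C \<T> \<S>" and Y: "balanced_fan L J E B \<T>' \<S>'"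
  obtains \<U> \<V> where
    "balanced_fan (K + L) (I \<times> J) (\<lambda>(i, j). D i \<times> E j) (\<lambda>(i, j). C i \<times> B j) \<U> \<V>"
proof -
  define \<U> where "\<U> = (\<lambda>(T, j). T \<times> E j) ` (\<T> \<times> J) \<union> (\<lambda>(i, T). D i \<times> T) ` (I \<times> \<T>')"
  define \<V> where "\<V> = (\<lambda>(S, j). S \<times> E j) ` (\<S> \<times> J) \<union> (\<lambda>(i, S). D i \<times> S) ` (I \<times> \<S>') \<union>
      (\<lambda>(T, T'). T \<times> T') ` (\<T> \<times> \<T>')"
  have X1: "subspace (D i)" "dim (D i) = K" "C i \<subseteq> D i" "closed (C i)"
      "\<exists>p\<in>C i. D i \<subseteq> feasible_directions (C i) p" if "i \<in> I" for i
    using X that by (auto simp: balanced_fan_def)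
  have Y1: "subspace (E j)" "dim (E j) = L" "B j \<subseteq> E j" "closed (B j)"
      "\<exists>q\<in>B j. E j \<subseteq> feasible_directions (B j) q" if "j \<in> J" for j
    using Y that by (auto simp: balanced_fan_def)
  have X2: "finite I" "finite \<T>" "finite \<S>" "\<And>T. T \<in> \<T> \<Longrightarrow> subspace T \<and> dim T + 1 \<le> K"
    "\<And>S. S \<in> \<S> \<Longrightarrow> subspace S \<and> dim S + 2 \<le> K" using X by (auto simp: balanced_fan_def)
  have Y2: "finite J" "finite \<T>'" "finite \<S>'" "\<And>T. T \<in> \<T>' \<Longrightarrow> subspace T \<and> dim T + 1 \<le> L"
    "\<And>S. S \<in> \<S>' \<Longrightarrow> subspace S \<and> dim S + 2 \<le> L" using Y by (auto simp: balanced_fan_def)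
  have X3: "D i \<subseteq> feasible_directions (C i) p \<or>
        (\<exists>T\<in>\<T>. \<exists>M. i \<in> M \<and> linear_star I D C p T M) \<or> (\<exists>S\<in>\<S>. p \<in> S)" if "i \<in> I" "p \<in> C i" for i p
    using X that unfolding balanced_fan_def by blast
  have Y3: "E j \<subseteq> feasible_directions (B j) q \<or>
        (\<exists>T\<in>\<T>'. \<exists>M. j \<in> M \<and> linear_star J E B q T M) \<or> (\<exists>S\<in>\<S>'. q \<in> S)" if "j \<in> J" "q \<in> B j" for j q
    using Y that unfolding balanced_fan_def by blast
  have classify: "D i \<times> E j \<subseteq> feasible_directions (C i \<times> B j) (p, q) \<or>
        (\<exists>T\<in>\<U>. \<exists>M. (i, j) \<in> M \<and> linear_star (I \<times> J) (\<lambda>(i, j). D i \<times> E j) (\<lambda>(i, j). C i \<times> B j) (p, q) T M) \<or>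
        (\<exists>S\<in>\<V>. (p, q) \<in> S)" (is "?int \<or> ?star \<or> ?low")
    if i: "i \<in> I" and p: "p \<in> C i" and j: "j \<in> J" and q: "q \<in> B j" for i j p q
  proof -
    have pq: "p \<in> D i" "q \<in> E j" using X1(3)[OF i] Y1(3)[OF j] p q by auto
    consider "D i \<subseteq> feasible_directions (C i) p" "E j \<subseteq> feasible_directions (B j) q"
      | T M where "D i \<subseteq> feasible_directions (C i) p" "T \<in> \<T>'" "j \<in> M" "linear_star J E B q T M"
      | T M where "E j \<subseteq> feasible_directions (B j) q" "T \<in> \<T>" "i \<in> M" "linear_star I D C p T M"
      | T M T' M' where "T \<in> \<T>" "linear_star I D C p T M" "T' \<in> \<T>'" "linear_star J E B q T' M'"
      | S where "S \<in> \<S>" "p \<in> S" | S where "S \<in> \<S>'" "q \<in> S"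
      using X3[OF i p] Y3[OF j q] 
      by (elim disjE bexE exE conjE)
        (rule that(5), assumption, assumption | rule that(6), assumption, assumption |
         rule that(1), assumption, assumption | rule that(2), assumption, assumption, assumption, assumption |
         rule that(3), assumption, assumption, assumption, assumption |
         rule that(4), assumption, assumption, assumption, assumption)+
    then show ?thesis
    proof cases
      case 1
      have ?int
      proof (clarify)
        fix a b assume "a \<in> D i" "b \<in> E j"
        then show "(a, b) \<in> feasible_directions (C i \<times> B j) (p, q)"
          by (intro feasible_directions_Times subsetD[OF 1(1)] subsetD[OF 1(2)])
      qed
      then show ?thesis by (rule disjI1)
    next
      case (2 T M)
      have "D i \<times> T \<in> \<U>" using i 2 by (auto simp: \<U>_def)
      moreover have "(i, j) \<in> {i} \<times> M" using 2 by simp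
      moreover have "linear_star (I \<times> J) (\<lambda>(i, j). D i \<times> E j) (\<lambda>(i, j). C i \<times> B j) (p, q)
          (D i \<times> T) ({i} \<times> M)"
        by (rule linear_star_Times_right) (fact 2 i X1(1)[OF i] pq)+
      ultimately have ?star
        by (intro bexI exI conjI)
      then show ?thesis by (intro disjI2 disjI1)
    next
      case (3 T M)
      have "T \<times> E j \<in> \<U>" using j 3 by (auto simp: \<U>_def)
      moreover have "(i, j) \<in> M \<times> {j}" using 3 by simp
      moreover have "linear_star (I \<times> J) (\<lambda>(i, j). D i \<times> E j) (\<lambda>(i, j). C i \<times> B j) (p, q)
          (T \<times> E j) (M \<times> {j})"
        by (rule linear_star_Times_left) (fact 3 j Y1(1)[OF j] pq)+
      ultimately have ?star
        by (intro bexI exI conjI)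
      then show ?thesis by (intro disjI2 disjI1)
    next
      case (4 T M T' M')
      then have "p \<in> T" "q \<in> T'" by (simp_all add: linear_star_def)
      with 4 have ?low by (intro bexI[of _ "T \<times> T'"]) (auto simp: \<V>_def)
      then show ?thesis by (intro disjI2)
    next
      case (5 S)
      then have ?low using pq j by (intro bexI[of _ "S \<times> E j"]) (auto simp: \<V>_def)
      then show ?thesis by (intro disjI2)
    next
      case (6 S)
      then have ?low using pq i by (intro bexI[of _ "D i \<times> S"]) (auto simp: \<V>_def)
      then show ?thesis by (intro disjI2)
    qed
  qed
  have "balanced_fan (K + L) (I \<times> J) (\<lambda>(i, j). D i \<times> E j) (\<lambda>(i, j). C i \<times> B j) \<U> \<V>"
    unfolding balanced_fan_def
  proof (intro conjI)
    show "finite (I \<times> J)" "finite \<U>" "finite \<V>"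
      unfolding \<U>_def \<V>_def by (intro finite_UnI finite_imageI finite_cartesian_product X2(1-3) Y2(1-3))+
    \<comment> \<open>The slacks \<open>a\<close> and \<open>a'\<close> are lower bounds for
      codimensions, which add up in products.\<close>
    have *: "subspace (A \<times> A') \<and> dim (A \<times> A') + n \<le> K + L"
      if "subspace A \<and> dim A + a \<le> K" "subspace A' \<and> dim A' + a' \<le> L" "n = a + a'"
      for A :: "'a set" and A' :: "'b set" and a a' n
      using that by (simp add: dim_Times subspace_Times)
    have Di: "subspace (D i) \<and> dim (D i) + 0 \<le> K" if "i \<in> I" for i using X1(1,2)[OF that] by simp
    have Ej: "subspace (E j) \<and> dim (E j) + 0 \<le> L" if "j \<in> J" for j using Y1(1,2)[OF that] by simp
    show "\<forall>T\<in>\<U>. subspace T \<and> dim T + 1 \<le> K + L"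
      unfolding \<U>_def
      by (safe; (rule *[OF X2(4) Ej, THEN conjunct1] *[OF X2(4) Ej, THEN conjunct2]
            *[OF Di Y2(4), THEN conjunct1] *[OF Di Y2(4), THEN conjunct2]; simp; fail))
    show "\<forall>S\<in>\<V>. subspace S \<and> dim S + 2 \<le> K + L"
      unfolding \<V>_def
      by (safe; (rule *[OF X2(5) Ej, THEN conjunct1] *[OF X2(5) Ej, THEN conjunct2]
            *[OF Di Y2(5), THEN conjunct1] *[OF Di Y2(5), THEN conjunct2]
            *[OF X2(4) Y2(4), THEN conjunct1] *[OF X2(4) Y2(4), THEN conjunct2]; simp; fail))
    show "\<forall>x\<in>I \<times> J. subspace (case x of (i, j) \<Rightarrow> D i \<times> E j) \<and>
        dim (case x of (i, j) \<Rightarrow> D i \<times> E j) = K + L \<and>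
        (case x of (i, j) \<Rightarrow> C i \<times> B j) \<subseteq> (case x of (i, j) \<Rightarrow> D i \<times> E j) \<and>
        closed (case x of (i, j) \<Rightarrow> C i \<times> B j) \<and>
        (\<exists>p\<in>case x of (i, j) \<Rightarrow> C i \<times> B j. (case x of (i, j) \<Rightarrow> D i \<times> E j)
           \<subseteq> feasible_directions (case x of (i, j) \<Rightarrow> C i \<times> B j) p)"
    proof
      fix x assume "x \<in> I \<times> J"
      then obtain i j where ij: "x = (i, j)" and i: "i \<in> I" and j: "j \<in> J" by blast
      have "subspace (D i \<times> E j)" "dim (D i \<times> E j) = K + L" "closed (C i \<times> B j)"
        using X1[OF i] Y1[OF j] by (auto simp: dim_Times subspace_Times closed_Times)
      moreover have "C i \<times> B j \<subseteq> D i \<times> E j" using X1(3)[OF i] Y1(3)[OF j] by blast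
      moreover have "\<exists>p\<in>C i \<times> B j. D i \<times> E j \<subseteq> feasible_directions (C i \<times> B j) p"
      proof -
        obtain p q where "p \<in> C i" "D i \<subseteq> feasible_directions (C i) p"
        "q \<in> B j" "E j \<subseteq> feasible_directions (B j) q" using X1(5)[OF i] Y1(5)[OF j] by blast
      then show "\<exists>p\<in>C i \<times> B j. D i \<times> E j \<subseteq> feasible_directions (C i \<times> B j) p"
        by (intro bexI[of _ "(p, q)"]) (auto intro: feasible_directions_Times)
      qed
      ultimately show "subspace (case x of (i, j) \<Rightarrow> D i \<times> E j) \<and>
        dim (case x of (i, j) \<Rightarrow> D i \<times> E j) = K + L \<and>
        (case x of (i, j) \<Rightarrow> C i \<times> B j) \<subseteq> (case x of (i, j) \<Rightarrow> D i \<times> E j) \<and>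
        closed (case x of (i, j) \<Rightarrow> C i \<times> B j) \<and>
        (\<exists>p\<in>case x of (i, j) \<Rightarrow> C i \<times> B j. (case x of (i, j) \<Rightarrow> D i \<times> E j)
           \<subseteq> feasible_directions (case x of (i, j) \<Rightarrow> C i \<times> B j) p)"
        unfolding ij prod.case by (intro conjI)
    qed
    show "\<forall>x\<in>I \<times> J. \<forall>p\<in>case x of (i, j) \<Rightarrow> C i \<times> B j.
        (case x of (i, j) \<Rightarrow> D i \<times> E j) \<subseteq> feasible_directions (case x of (i, j) \<Rightarrow> C i \<times> B j) p \<or>
        (\<exists>T\<in>\<U>. \<exists>M. x \<in> M \<and>
           linear_star (I \<times> J) (\<lambda>(i, j). D i \<times> E j) (\<lambda>(i, j). C i \<times> B j) p T M) \<or>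
        (\<exists>S\<in>\<V>. p \<in> S)"
    proof (intro ballI)
      fix x z assume x: "x \<in> I \<times> J" and z: "z \<in> (case x of (i, j) \<Rightarrow> C i \<times> B j)"
      obtain i j where ij: "x = (i, j)" by (cases x)
      obtain p q where pq: "z = (p, q)" by (cases z)
      have "i \<in> I" "p \<in> C i" "j \<in> J" "q \<in> B j" using x z ij pq by auto
      from classify[OF this] show "(case x of (i, j) \<Rightarrow> D i \<times> E j) \<subseteq> feasible_directions (case x of (i, j) \<Rightarrow> C i \<times> B j) z \<or>
        (\<exists>T\<in>\<U>. \<exists>M. x \<in> M \<and>
           linear_star (I \<times> J) (\<lambda>(i, j). D i \<times> E j) (\<lambda>(i, j). C i \<times> B j) z T M) \<or>
        (\<exists>S\<in>\<V>. z \<in> S)" unfolding ij pq prod.case .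
    qed
  qed
  then show ?thesis using that by blast
qed

section \<open>Rational polyhedra and feasible directions\<close>

definition direction_space :: "'a::euclidean_space set \<Rightarrow> 'a set" where
  "direction_space \<sigma> = {x - y |x y. x \<in> affine hull \<sigma> \<and> y \<in> affine hull \<sigma>}"

lemma direction_space_eq:
  assumes "a \<in> affine hull \<sigma>"
  shows "direction_space \<sigma> = (\<lambda>x. x - a) ` (affine hull \<sigma>)"
proof (intro equalityI subsetI)
  fix u assume "u \<in> direction_space \<sigma>"
  then obtain x y where "u = x - y" "x \<in> affine hull \<sigma>" "y \<in> affine hull \<sigma>"
    by (auto simp: direction_space_def)
  moreover from this have "a + 1 *\<^sub>R (x - y) \<in> affine hull \<sigma>"
    using assms by (intro mem_affine_3_minus affine_affine_hull)
  ultimately show "u \<in> (\<lambda>x. x - a) ` (affine hull \<sigma>)"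
    by (intro rev_image_eqI[of "a + (x - y)"]) auto
qed (use assms in \<open>auto simp: direction_space_def\<close>)

lemma subspace_direction_space: "\<sigma> \<noteq> {} \<Longrightarrow> subspace (direction_space \<sigma>)"
  using affine_diffs_subspace_subtract[OF affine_affine_hull] direction_space_eq
  by (metis affine_hull_eq_empty ex_in_conv)

lemma dim_direction_space:
  assumes "\<sigma> \<noteq> {}"
  shows "int (dim (direction_space \<sigma>)) = aff_dim \<sigma>"
proof -
  obtain a where a: "a \<in> affine hull \<sigma>" using assms by fastforce
  then have "aff_dim (affine hull \<sigma>) = int (dim ((\<lambda>x. x - a) ` (affine hull \<sigma>)))"
    by (intro aff_dim_eq_dim_subtract) (simp add: hull_hull)
  then show ?thesis by (simp add: direction_space_eq[OF a])
qed

lemma direction_space_mono: "\<tau> \<subseteq> \<sigma> \<Longrightarrow> direction_space \<tau> \<subseteq> direction_space \<sigma>"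
  using hull_mono[of \<tau> \<sigma> affine] by (auto simp: direction_space_def)

lemma diff_in_direction_space: "x \<in> \<sigma> \<Longrightarrow> y \<in> \<sigma> \<Longrightarrow> x - y \<in> direction_space \<sigma>"
  by (auto simp: direction_space_def intro: hull_inc)

lemma parallel_lattice_eq: "parallel_lattice \<sigma> = lattice_vectors \<inter> direction_space \<sigma>"
  by (simp add: parallel_lattice_def direction_space_def)

lemma link_cell_eq: "link_cell p \<sigma> = feasible_directions \<sigma> p"
  by (simp add: link_cell_def feasible_directions_def)

section \<open>Feasible directions of convex sets\<close>

lemma feasible_directionsE:
  assumes "u \<in> feasible_directions \<sigma> p"
  obtains \<epsilon> where "0 < \<epsilon>" "\<epsilon> < 1" "p + \<epsilon> *\<^sub>R u \<in> \<sigma>"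
proof -
  have "\<forall>\<^sub>F \<epsilon> in at_right (0::real). 0 < \<epsilon> \<and> \<epsilon> < 1"
    by (rule eventually_at_rightI[of 0 1]) auto
  with assms have "\<forall>\<^sub>F \<epsilon> in at_right 0. p + \<epsilon> *\<^sub>R u \<in> \<sigma> \<and> 0 < \<epsilon> \<and> \<epsilon> < 1"
    by (simp add: feasible_directions_def eventually_conj_iff)
  then show ?thesis using that eventually_happens' trivial_limit_at_right_real by blast
qed

text \<open>By convexity, a single point of \<open>\<sigma>\<close> on the ray brings the whole
  segment from \<open>p\<close> to it.\<close>

lemma feasible_directionsI:
  assumes "convex \<sigma>" "p \<in> \<sigma>" "0 < e" "p + e *\<^sub>R u \<in> \<sigma>"
  shows "u \<in> feasible_directions \<sigma> p"
  unfolding feasible_directions_def mem_Collect_eq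
proof (rule eventually_at_rightI[of 0 e])
  fix \<epsilon> assume "\<epsilon> \<in> {0<..<e}"
  then have "(1 - \<epsilon>/e) *\<^sub>R p + (\<epsilon>/e) *\<^sub>R (p + e *\<^sub>R u) \<in> \<sigma>"
    using assms by (intro convexD) auto
  also have "(1 - \<epsilon>/e) *\<^sub>R p + (\<epsilon>/e) *\<^sub>R (p + e *\<^sub>R u) = p + \<epsilon> *\<^sub>R u"
    using assms(3) by (simp add: algebra_simps)
  finally show "p + \<epsilon> *\<^sub>R u \<in> \<sigma>" .
qed (use assms in auto)

lemma feasible_directions_diff: "convex \<sigma> \<Longrightarrow> p \<in> \<sigma> \<Longrightarrow> q \<in> \<sigma> \<Longrightarrow> q - p \<in> feasible_directions \<sigma> p"
  using feasible_directionsI[of \<sigma> p 1 "q - p"] by simp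

lemma feasible_directions_mono: "\<tau> \<subseteq> \<sigma> \<Longrightarrow> feasible_directions \<tau> p \<subseteq> feasible_directions \<sigma> p"
  by (auto simp: feasible_directions_def elim!: eventually_mono)

text \<open>The point \<open>p + \<epsilon> *\<^sub>R (u + w)\<close> is the midpoint of the points
  reached along \<open>2 *\<^sub>R u\<close> and \<open>2 *\<^sub>R w\<close>.\<close>

lemma feasible_directions_add:
  assumes "convex \<sigma>" "u \<in> feasible_directions \<sigma> p" "w \<in> feasible_directions \<sigma> p"
  shows "u + w \<in> feasible_directions \<sigma> p"
proof -
  have "2 *\<^sub>R u \<in> feasible_directions \<sigma> p" "2 *\<^sub>R w \<in> feasible_directions \<sigma> p"
    using assms by (auto intro: feasible_directions_scale)
  then have "\<forall>\<^sub>F \<epsilon> in at_right 0. p + \<epsilon> *\<^sub>R 2 *\<^sub>R u \<in> \<sigma> \<and> p + \<epsilon> *\<^sub>R 2 *\<^sub>R w \<in> \<sigma>"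
    by (simp add: feasible_directions_def eventually_conj_iff)
  then have "\<forall>\<^sub>F \<epsilon> in at_right 0. p + \<epsilon> *\<^sub>R (u + w) \<in> \<sigma>"
  proof eventually_elim
    case (elim \<epsilon>)
    then have "(1/2) *\<^sub>R (p + \<epsilon> *\<^sub>R 2 *\<^sub>R u) + (1/2) *\<^sub>R (p + \<epsilon> *\<^sub>R 2 *\<^sub>R w) \<in> \<sigma>"
      using assms(1) by (intro convexD) auto
    also have "(1/2) *\<^sub>R (p + \<epsilon> *\<^sub>R 2 *\<^sub>R u) + (1/2) *\<^sub>R (p + \<epsilon> *\<^sub>R 2 *\<^sub>R w)
        = ((1/2) *\<^sub>R p + (1/2) *\<^sub>R p) + \<epsilon> *\<^sub>R (u + w)"
      by (simp only: scaleR_add_right scaleR_scaleR) simp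
    also have "(1/2) *\<^sub>R p + (1/2) *\<^sub>R p = p" by (simp flip: scaleR_add_left)
    finally show ?case .
  qed
  then show ?thesis by (simp add: feasible_directions_def)
qed

lemma feasible_directions_subset_direction_space:
  assumes "p \<in> \<sigma>"
  shows "feasible_directions \<sigma> p \<subseteq> direction_space \<sigma>"
proof
  fix u assume "u \<in> feasible_directions \<sigma> p"
  then obtain \<epsilon> where \<epsilon>: "0 < \<epsilon>" "p + \<epsilon> *\<^sub>R u \<in> \<sigma>" by (rule feasible_directionsE)
  then have "\<epsilon> *\<^sub>R u \<in> direction_space \<sigma>" using diff_in_direction_space[OF \<epsilon>(2) assms] by simp
  then have "(1/\<epsilon>) *\<^sub>R \<epsilon> *\<^sub>R u \<in> direction_space \<sigma>"
    by (rule subspace_scale[rotated]) (use assms in \<open>auto intro: subspace_direction_space\<close>)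
  then show "u \<in> direction_space \<sigma>" using \<epsilon> by simp
qed

text \<open>Near a relative interior point, \<open>\<sigma>\<close> fills its affine hull.\<close>

lemma direction_space_subset_feasible_directions:
  assumes "q \<in> rel_interior \<sigma>"
  shows "direction_space \<sigma> \<subseteq> feasible_directions \<sigma> q"
proof
  fix u assume u: "u \<in> direction_space \<sigma>"
  obtain e where e: "e > 0" "ball q e \<inter> affine hull \<sigma> \<subseteq> \<sigma>"
    using assms by (auto simp: mem_rel_interior_ball)
  obtain x y where xy: "u = x - y" "x \<in> affine hull \<sigma>" "y \<in> affine hull \<sigma>"
    using u by (auto simp: direction_space_def)
  have q: "q \<in> affine hull \<sigma>" using assms rel_interior_subset hull_inc by (metis subsetD)
  have "((\<lambda>\<epsilon>. q + \<epsilon> *\<^sub>R u) \<longlongrightarrow> q + 0 *\<^sub>R u) (at_right 0)" by (intro tendsto_intros)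
  then have "\<forall>\<^sub>F \<epsilon> in at_right 0. q + \<epsilon> *\<^sub>R u \<in> ball q e"
    using e by (intro topological_tendstoD) auto
  then have "\<forall>\<^sub>F \<epsilon> in at_right 0. q + \<epsilon> *\<^sub>R u \<in> \<sigma>"
  proof eventually_elim
    case (elim \<epsilon>)
    have "q + \<epsilon> *\<^sub>R u \<in> affine hull \<sigma>" unfolding xy(1)
      by (intro mem_affine_3_minus affine_affine_hull q xy)
    then show ?case using elim e by blast
  qed
  then show "u \<in> feasible_directions \<sigma> q" by (simp add: feasible_directions_def)
qed

text \<open>Scaling by \<open>1/e\<close> about \<open>p\<close> sends points of
  \<open>\<sigma>\<close> to directions feasible at \<open>p\<close>. This transfers what is known
  at a point of \<open>\<sigma>\<close> near \<open>p\<close> to the cone of \<open>\<sigma>\<close>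
  at \<open>p\<close>.\<close>

lemma feasible_directions_link:
  assumes "convex \<sigma>" "p \<in> \<sigma>" "0 < e" "w \<in> feasible_directions \<sigma> (p + e *\<^sub>R u)"
  shows "w \<in> feasible_directions (feasible_directions \<sigma> p) u"
proof -
  have "e *\<^sub>R w \<in> feasible_directions \<sigma> (p + e *\<^sub>R u)"
    using assms by (intro feasible_directions_scale)
  then have "\<forall>\<^sub>F \<epsilon> in at_right 0. p + e *\<^sub>R u + \<epsilon> *\<^sub>R e *\<^sub>R w \<in> \<sigma>"
    by (simp add: feasible_directions_def)
  then have "\<forall>\<^sub>F \<epsilon> in at_right 0. u + \<epsilon> *\<^sub>R w \<in> feasible_directions \<sigma> p"
  proof eventually_elim
    case (elim \<epsilon>)
    then show ?case using assms by (intro feasible_directionsI[of \<sigma> p e]) (simp_all add: algebra_simps)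
  qed
  then show ?thesis by (simp add: feasible_directions_def[of _ u])
qed

text \<open>Prolong the segment from \<open>p\<close> through \<open>q\<close> to a further point of
  \<open>\<tau>\<close>. Contracting towards that point moves \<open>p\<close> to \<open>q\<close>
  and the points \<open>p + \<epsilon> *\<^sub>R v\<close> to \<open>q\<close> plus positive
  multiples of \<open>v\<close>, and stays inside the convex set \<open>\<sigma>\<close>.\<close>

lemma feasible_directions_rel_interior:
  fixes \<sigma> :: "'a::euclidean_space set"
  assumes "convex \<tau>" "\<tau> \<subseteq> \<sigma>" "convex \<sigma>" "p \<in> \<tau>" "q \<in> rel_interior \<tau>" "v \<in> feasible_directions \<sigma> p"
  shows "v \<in> feasible_directions \<sigma> q"
proof -
  have "\<tau> \<noteq> {}" using assms(4) by blast
  then obtain e where e: "e > 1" "(1 - e) *\<^sub>R p + e *\<^sub>R q \<in> \<tau>"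
    using convex_rel_interior_iff[of \<tau> q] assms by blast
  have "\<forall>\<^sub>F \<epsilon> in at_right 0. p + \<epsilon> *\<^sub>R v \<in> \<sigma>" using assms by (simp add: feasible_directions_def)
  then have "\<forall>\<^sub>F \<epsilon> in at_right 0. q + \<epsilon> *\<^sub>R (1 - 1/e) *\<^sub>R v \<in> \<sigma>"
  proof eventually_elim
    case (elim \<epsilon>)
    have "(1/e) *\<^sub>R ((1 - e) *\<^sub>R p + e *\<^sub>R q) + (1 - 1/e) *\<^sub>R (p + \<epsilon> *\<^sub>R v) \<in> \<sigma>"
      by (rule convexD[OF assms(3)]) (use assms(2) e elim in auto)
    also have "(1/e) *\<^sub>R ((1 - e) *\<^sub>R p + e *\<^sub>R q) + (1 - 1/e) *\<^sub>R (p + \<epsilon> *\<^sub>R v)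
       = ((1/e) * (1 - e) + (1 - 1/e)) *\<^sub>R p + q + \<epsilon> *\<^sub>R (1 - 1/e) *\<^sub>R v"
      using e by (simp only: scaleR_add_right scaleR_add_left scaleR_scaleR) (simp add: mult.commute)
    also have "(1/e) * (1 - e) + (1 - 1/e) = 0" using e by (simp add: field_simps)
    finally show ?case by simp
  qed
  then have "(1 - 1/e) *\<^sub>R v \<in> feasible_directions \<sigma> q" by (simp add: feasible_directions_def)
  then have "(1/(1 - 1/e)) *\<^sub>R (1 - 1/e) *\<^sub>R v \<in> feasible_directions \<sigma> q"
    by (rule feasible_directions_scale) (use e in auto)
  then show ?thesis using e by (simp add: field_simps)
qed

lemma eventually_not_in_closed:
  fixes \<rho> :: "'a::real_normed_vector set"
  assumes "closed \<rho>" "p \<notin> \<rho>"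
  shows "\<forall>\<^sub>F \<epsilon> in at_right (0::real). p + \<epsilon> *\<^sub>R u \<notin> \<rho>"
proof -
  have "((\<lambda>\<epsilon>. p + \<epsilon> *\<^sub>R u) \<longlongrightarrow> p + 0 *\<^sub>R u) (at_right 0)" by (intro tendsto_intros)
  then have "\<forall>\<^sub>F \<epsilon> in at_right 0. p + \<epsilon> *\<^sub>R u \<in> - \<rho>"
    using assms by (intro topological_tendstoD) auto
  then show ?thesis by simp
qed

section \<open>Half-space descriptions and lattice points\<close>

lemma feasible_directions_halfspace:
  assumes "u \<bullet> p \<le> c"
  shows "feasible_directions {x. u \<bullet> x \<le> c} p = (if u \<bullet> p = c then {x. u \<bullet> x \<le> 0} else UNIV)"
proof (cases "u \<bullet> p = c")
  case True
  have "x \<in> feasible_directions {x. u \<bullet> x \<le> c} p \<longleftrightarrow> u \<bullet> x \<le> 0" for x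
  proof
    assume "x \<in> feasible_directions {x. u \<bullet> x \<le> c} p"
    then show "u \<bullet> x \<le> 0"
      by (rule feasible_directionsE) (use True in \<open>auto simp: inner_add_right mult_le_0_iff\<close>)
  next
    assume "u \<bullet> x \<le> 0"
    then show "x \<in> feasible_directions {x. u \<bullet> x \<le> c} p"
      using True by (intro feasible_directionsI[of _ _ 1] convex_halfspace_le) (auto simp: inner_add_right)
  qed
  then show ?thesis using True by auto
next
  case False
  have "x \<in> feasible_directions {x. u \<bullet> x \<le> c} p" for x
  proof -
    have "((\<lambda>\<epsilon>. u \<bullet> (p + \<epsilon> *\<^sub>R x)) \<longlongrightarrow> u \<bullet> (p + 0 *\<^sub>R x)) (at_right 0)" by (intro tendsto_intros)
    then have "\<forall>\<^sub>F \<epsilon> in at_right 0. u \<bullet> (p + \<epsilon> *\<^sub>R x) < c"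
      using False assms by (intro order_tendstoD(2)) auto
    then show ?thesis by (auto simp: feasible_directions_def elim!: eventually_mono)
  qed
  then show ?thesis using False by auto
qed

lemma feasible_directions_INT:
  "finite A \<Longrightarrow> feasible_directions (\<Inter>a\<in>A. H a) p = (\<Inter>a\<in>A. feasible_directions (H a) p)"
  by (auto simp: feasible_directions_def eventually_ball_finite_distrib)

lemma rational_polyhedronE:
  fixes \<sigma> :: "(real ^ 'n) set"
  assumes "rational_polyhedron \<sigma>"
  obtains A where "finite A" "\<sigma> = (\<Inter>a\<in>A. {x. fst a \<bullet> x \<le> snd a})" "fst ` A \<subseteq> lattice_vectors"
proof -
  obtain F where F: "finite F" "\<sigma> = \<Inter>F"
    and "\<forall>h\<in>F. \<exists>u c. u \<in> lattice_vectors \<and> h = {x. u \<bullet> x \<le> c}"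
    using assms by (auto simp: rational_polyhedron_def)
  then have "\<forall>h\<in>F. \<exists>a. fst a \<in> lattice_vectors \<and> h = {x. fst a \<bullet> x \<le> snd a}" by simp
  from bchoice[OF this] obtain f
    where f: "\<And>h. h \<in> F \<Longrightarrow> fst (f h) \<in> lattice_vectors"
      "\<And>h. h \<in> F \<Longrightarrow> {x. fst (f h) \<bullet> x \<le> snd (f h)} = h" by blast
  have "\<sigma> = (\<Inter>a\<in>f ` F. {x. fst a \<bullet> x \<le> snd a})"
  proof -
    have "(\<lambda>h. {x. fst (f h) \<bullet> x \<le> snd (f h)}) ` F = (\<lambda>h. h) ` F"
      by (rule image_cong) (simp_all add: f(2))
    then show ?thesis by (simp add: F(2) image_image)
  qed
  then show ?thesis using F(1) f(1) by (intro that[of "f ` F"]) auto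
qed

lemma polyhedron_rational_polyhedron:
  assumes "rational_polyhedron \<sigma>"
  shows "polyhedron \<sigma>"
  using assms by (rule rational_polyhedronE) (auto intro!: polyhedron_Inter polyhedron_halfspace_le)

text \<open>Slack constraints do not restrict small moves, and tight ones become homogeneous. In
  particular the feasible directions form a closed cone.\<close>

lemma feasible_directions_halfspaces:
  assumes "finite A" "p \<in> (\<Inter>a\<in>A. {x. fst a \<bullet> x \<le> snd a})"
  shows "feasible_directions (\<Inter>a\<in>A. {x. fst a \<bullet> x \<le> snd a}) p =
    (\<Inter>a\<in>{a \<in> A. fst a \<bullet> p = snd a}. {x. fst a \<bullet> x \<le> 0})"
proof -
  have "feasible_directions {x. fst a \<bullet> x \<le> snd a} p =
      (if fst a \<bullet> p = snd a then {x. fst a \<bullet> x \<le> 0} else UNIV)" if "a \<in> A" for a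
    using assms that by (intro feasible_directions_halfspace) auto
  then have "feasible_directions (\<Inter>a\<in>A. {x. fst a \<bullet> x \<le> snd a}) p =
      (\<Inter>a\<in>A. if fst a \<bullet> p = snd a then {x. fst a \<bullet> x \<le> 0} else UNIV)"
    unfolding feasible_directions_INT[OF assms(1)] by (rule INF_cong[OF refl])
  then show ?thesis by (auto split: if_splits)
qed

lemma closed_feasible_directions:
  fixes \<sigma> :: "(real ^ 'n) set"
  assumes "rational_polyhedron \<sigma>" "p \<in> \<sigma>"
  shows "closed (feasible_directions \<sigma> p)"
proof -
  obtain A where A: "finite A" "\<sigma> = (\<Inter>a\<in>A. {x. fst a \<bullet> x \<le> snd a})"
    using assms(1) by (rule rational_polyhedronE)
  show ?thesis
    using assms(2) unfolding A(2)
    by (subst feasible_directions_halfspaces[OF A(1)]) (auto intro!: closed_INT closed_halfspace_le)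
qed

lemma lattice_inner_Ints:
  assumes "a \<in> lattice_vectors" "b \<in> lattice_vectors"
  shows "a \<bullet> b \<in> \<int>"
  using assms by (auto simp: lattice_vectors_def inner_vec_def intro!: Ints_sum Ints_mult)

text \<open>A subspace cut out by integral equations is spanned by lattice vectors. Each new
  equation either already holds on the lattice vectors at hand or is enforced by a multiple of a
  projection that preserves the lattice.\<close>

lemma span_lattice_orthogonal:
  fixes A :: "(real ^ 'n) set"
  assumes "finite A" "A \<subseteq> lattice_vectors"
  shows "{x. \<forall>a\<in>A. a \<bullet> x = 0} \<subseteq> span (lattice_vectors \<inter> {x. \<forall>a\<in>A. a \<bullet> x = 0})"
  using assms
proof (induction A)
  case empty
  have "(Basis :: (real ^ 'n) set) \<subseteq> lattice_vectors"
    by (auto simp: Basis_vec_def lattice_vectors_def axis_def)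
  then have "UNIV \<subseteq> span (lattice_vectors :: (real ^ 'n) set)"
    using span_mono span_Basis by blast
  then show ?case by simp
next
  case (insert a A)
  define L where "L = lattice_vectors \<inter> {x. \<forall>a\<in>A. a \<bullet> x = 0}"
  define L' where "L' = lattice_vectors \<inter> {x. \<forall>b\<in>insert a A. b \<bullet> x = 0}"
  have IH: "{x. \<forall>a\<in>A. a \<bullet> x = 0} \<subseteq> span L" unfolding L_def using insert by auto
  have "{x. \<forall>b\<in>insert a A. b \<bullet> x = 0} \<subseteq> span L'"
  proof (cases "\<forall>b\<in>L. a \<bullet> b = 0")
    case True
    then have "L = L'" by (auto simp: L_def L'_def)
    then show ?thesis using IH by auto
  next
    case False
    then obtain b where b: "b \<in> L" "a \<bullet> b \<noteq> 0" by blast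
    \<comment> \<open>\<open>P\<close> is \<open>a \<bullet> b\<close> times the projection along \<open>b\<close> onto the hyperplane orthogonal to \<open>a\<close>;
      the factor keeps it integral.\<close>
    define P where "P x = (a \<bullet> b) *\<^sub>R x - (a \<bullet> x) *\<^sub>R b" for x
    have P: "linear P" unfolding P_def
      by (intro linearI) (simp_all add: algebra_simps inner_add_right)
    have PL: "P ` L \<subseteq> L'"
    proof (rule image_subsetI)
      fix x assume x: "x \<in> L"
      have "a \<bullet> b \<in> \<int>" "a \<bullet> x \<in> \<int>"
        using x b insert.prems by (auto simp: L_def intro: lattice_inner_Ints)
      then have "P x \<in> lattice_vectors"
        using x b by (auto simp: P_def L_def lattice_vectors_def intro!: Ints_diff Ints_mult)
      then show "P x \<in> L'" using x b by (auto simp: P_def L_def L'_def inner_diff_right)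
    qed
    show ?thesis
    proof
      fix x assume x: "x \<in> {x. \<forall>b\<in>insert a A. b \<bullet> x = 0}"
      then have "x \<in> span L" using IH by auto
      then have "P x \<in> span L'"
        using linear_span_image[OF P, of L] span_mono[OF PL] by blast
      then have "(1/(a \<bullet> b)) *\<^sub>R P x \<in> span L'" by (rule span_scale)
      then show "x \<in> span L'" using x b by (simp add: P_def)
    qed
  qed
  then show ?case by (simp add: L'_def)
qed

text \<open>At a relative interior point the feasible directions form a linear space, so the
  constraints tight there hold with equality along it. Their normals are integral, and the preceding
  lemma applies.\<close>

lemma direction_space_subset_span_parallel_lattice:
  fixes \<sigma> :: "(real ^ 'n) set"
  assumes "rational_polyhedron \<sigma>" "\<sigma> \<noteq> {}"
  shows "direction_space \<sigma> \<subseteq> span (parallel_lattice \<sigma>)"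
proof -
  obtain H where H: "finite H" "\<sigma> = (\<Inter>a\<in>H. {x. fst a \<bullet> x \<le> snd a})" "fst ` H \<subseteq> lattice_vectors"
    using assms(1) by (rule rational_polyhedronE)
  have "convex \<sigma>" using assms by (intro polyhedron_imp_convex polyhedron_rational_polyhedron)
  then obtain q where q: "q \<in> rel_interior \<sigma>" using assms(2) rel_interior_eq_empty by blast
  then have q\<sigma>: "q \<in> \<sigma>" using rel_interior_subset by blast
  define A where "A = fst ` {a \<in> H. fst a \<bullet> q = snd a}"
  have feas: "feasible_directions \<sigma> q = {x. \<forall>a\<in>A. a \<bullet> x \<le> 0}"
    using q\<sigma> unfolding H(2) by (subst feasible_directions_halfspaces[OF H(1)]) (auto simp: A_def)
  have eq: "direction_space \<sigma> = {x. \<forall>a\<in>A. a \<bullet> x = 0}"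
  proof (intro equalityI subsetI)
    fix x assume x: "x \<in> direction_space \<sigma>"
    then have "- x \<in> direction_space \<sigma>" using subspace_direction_space[OF assms(2)] subspace_neg by blast
    with x have "x \<in> feasible_directions \<sigma> q" "- x \<in> feasible_directions \<sigma> q"
      using direction_space_subset_feasible_directions[OF q] by auto
    then show "x \<in> {x. \<forall>a\<in>A. a \<bullet> x = 0}" unfolding feas by force
  next
    fix x assume "x \<in> {x. \<forall>a\<in>A. a \<bullet> x = 0}"
    then have "x \<in> feasible_directions \<sigma> q" unfolding feas by auto
    then show "x \<in> direction_space \<sigma>" using feasible_directions_subset_direction_space[OF q\<sigma>] by blast
  qed
  show ?thesis unfolding parallel_lattice_eq eq
    using H(1,3) by (intro span_lattice_orthogonal) (auto simp: A_def)
qed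

text \<open>\<open>primitive_normal\<close> speaks of lattices only. Taking real spans gives the
  corresponding splitting of linear spaces, because a rational polyhedron has enough parallel
  lattice vectors.\<close>

lemma primitive_normal_direction_space:
  fixes \<sigma> :: "(real ^ 'n) set"
  assumes "rational_polyhedron \<sigma>" "\<tau> \<subseteq> \<sigma>" "\<tau> \<noteq> {}" "primitive_normal \<tau> \<sigma> v"
  shows "direction_space \<sigma> = {x + c *\<^sub>R v |x c. x \<in> direction_space \<tau>}"
proof
  have \<sigma>: "\<sigma> \<noteq> {}" using assms by blast
  have pl: "parallel_lattice \<sigma> = {w + of_int m *\<^sub>R v |w m. w \<in> parallel_lattice \<tau>}"
    using assms(4) by (simp add: primitive_normal_def)
  have sub: "subspace (direction_space \<tau>)" by (rule subspace_direction_space[OF assms(3)])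
  have sub': "subspace (direction_space \<sigma>)" by (rule subspace_direction_space[OF \<sigma>])
  have eq: "{x + c *\<^sub>R v |x c. x \<in> direction_space \<tau>} = {x + y |x y. x \<in> direction_space \<tau> \<and> y \<in> span {v}}"
    by (auto simp: span_singleton)
  have "subspace {x + c *\<^sub>R v |x c. x \<in> direction_space \<tau>}"
    unfolding eq by (intro subspace_sums sub subspace_span)
  moreover have "parallel_lattice \<sigma> \<subseteq> {x + c *\<^sub>R v |x c. x \<in> direction_space \<tau>}"
    unfolding pl by (auto simp: parallel_lattice_eq)
  ultimately show "direction_space \<sigma> \<subseteq> {x + c *\<^sub>R v |x c. x \<in> direction_space \<tau>}"
    using direction_space_subset_span_parallel_lattice[OF assms(1) \<sigma>] span_minimal by blast
  have "0 \<in> parallel_lattice \<tau>"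
    using subspace_0[OF sub] by (simp add: parallel_lattice_eq lattice_vectors_def)
  then have "0 + of_int 1 *\<^sub>R v \<in> parallel_lattice \<sigma>" unfolding pl by blast
  then have "v \<in> direction_space \<sigma>" by (simp add: parallel_lattice_eq)
  then show "{x + c *\<^sub>R v |x c. x \<in> direction_space \<tau>} \<subseteq> direction_space \<sigma>"
    using direction_space_mono[OF assms(2)] by (auto intro!: subspace_add subspace_scale sub')
qed

text \<open>Real subspaces are closed under rational combinations; this turns the rational balancing
  condition into a real one.\<close>

lemma rat_span_subset:
  assumes "subspace U" "A \<subseteq> U"
  shows "rat_span A \<subseteq> U"
proof -
  interpret rat: vector_space "\<lambda>(q::rat) (x::real ^ 'a). of_rat q *\<^sub>R x" by (rule vector_space_rat)
  show ?thesis unfolding rat_span_def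
    using assms by (intro rat.span_minimal rat.subspaceI) (auto intro: subspace_0 subspace_add subspace_scale)
qed

section \<open>Links, limits and stable intersection\<close>

lemma polyhedral_complexD:
  fixes \<sigma> :: "(real ^ 'n) set"
  assumes "polyhedral_complex \<C>" "\<sigma> \<in> \<C>"
  shows "rational_polyhedron \<sigma>" "\<sigma> \<noteq> {}" "convex \<sigma>" "closed \<sigma>"
proof -
  show "rational_polyhedron \<sigma>" "\<sigma> \<noteq> {}" using assms by (auto simp: polyhedral_complex_def)
  then show "convex \<sigma>" "closed \<sigma>"
    by (auto intro: polyhedron_imp_convex polyhedron_imp_closed polyhedron_rational_polyhedron)
qed

text \<open>In a minimal cell containing \<open>q\<close>, the point cannot lie on the relative
  boundary, since a facet of that cell through \<open>q\<close> would be a smaller cell.\<close>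

lemma polyhedral_complex_rel_interior:
  assumes "polyhedral_complex \<C>" "\<sigma> \<in> \<C>" "q \<in> \<sigma>"
  obtains \<tau> where "\<tau> \<in> \<C>" "\<tau> \<subseteq> \<sigma>" "q \<in> rel_interior \<tau>"
proof -
  define A where "A = {\<tau> \<in> \<C>. \<tau> \<subseteq> \<sigma> \<and> q \<in> \<tau>}"
  have "finite A" using assms(1) by (simp add: polyhedral_complex_def A_def)
  moreover have "\<sigma> \<in> A" using assms(2,3) by (simp add: A_def)
  then have "A \<noteq> {}" by blast
  ultimately obtain \<tau> where "\<tau> \<in> A" and min: "\<forall>\<rho>\<in>A. \<rho> \<subseteq> \<tau> \<longrightarrow> \<tau> = \<rho>"
    using finite_has_minimal[of A] by blast
  then have \<tau>: "\<tau> \<in> \<C>" "\<tau> \<subseteq> \<sigma>" "q \<in> \<tau>" by (auto simp: A_def)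
  have "q \<in> rel_interior \<tau>"
  proof (rule ccontr)
    assume "q \<notin> rel_interior \<tau>"
    then have "q \<in> \<Union>{F. F facet_of \<tau>}"
      using \<tau>(3) rel_boundary_of_polyhedron[OF polyhedron_rational_polyhedron[OF polyhedral_complexD(1)[OF assms(1) \<tau>(1)]]]
      by blast
    then obtain F where F: "F face_of \<tau>" "aff_dim F = aff_dim \<tau> - 1" "q \<in> F"
      by (auto simp: facet_of_def)
    then have "F \<in> \<C>" using assms(1) \<tau>(1) unfolding polyhedral_complex_def by blast
    moreover have "F \<subseteq> \<tau>" using F(1) by (rule face_of_imp_subset)
    moreover from calculation have "F \<in> A" using \<tau>(2) F(3) by (auto simp: A_def)
    ultimately have "\<tau> = F" using min by blast
    then show False using F(2) by simp
  qed
  then show ?thesis using that \<tau> by blast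
qed

lemma finite_facets: "polyhedral_complex (cells X) \<Longrightarrow> finite (facets X)"
  by (auto simp: polyhedral_complex_def facets_def)

text \<open>The cones at \<open>\<omega>\<close> of the facets through \<open>\<omega>\<close> form
  the fan. A vector \<open>u\<close> of a cone is classified by the cell \<open>\<tau>\<close> with
  \<open>\<omega> + \<epsilon> *\<^sub>R u\<close> in its relative interior for a small
  \<open>\<epsilon>\<close>: it is the facet itself, a ridge, at which balancing is used, or a
  smaller cell.\<close>

proposition balanced_fan_link:
  fixes X :: "(real ^ 'n) weighted_complex"
  assumes X: "tropical_cycle k X" "positive_multiplicities X"
  obtains \<T> \<S> where
    "balanced_fan k {\<sigma> \<in> facets X. \<omega> \<in> \<sigma>} direction_space (\<lambda>\<sigma>. feasible_directions \<sigma> \<omega>) \<T> \<S>"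
proof -
  have cpx: "polyhedral_complex (cells X)" and pure: "pure_dim k X" and bal: "balanced k X"
    using X(1) by (auto simp: tropical_cycle_def)
  define I where "I = {\<sigma> \<in> facets X. \<omega> \<in> \<sigma>}"
  define \<T> where "\<T> = direction_space ` {\<tau> \<in> cells X. aff_dim \<tau> = int k - 1}"
  define \<S> where "\<S> = direction_space ` {\<tau> \<in> cells X. aff_dim \<tau> \<le> int k - 2}"
  have fin: "finite (cells X)" using cpx by (simp add: polyhedral_complex_def)
  have cell: "\<sigma> \<in> cells X" if "\<sigma> \<in> facets X" for \<sigma> using that by (simp add: facets_def)
  note D = polyhedral_complexD[OF cpx]
  have "balanced_fan k I direction_space (\<lambda>\<sigma>. feasible_directions \<sigma> \<omega>) \<T> \<S>"
    unfolding balanced_fan_def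
  proof (intro conjI)
    show "finite I" "finite \<T>" "finite \<S>"
      using finite_facets[OF cpx] fin by (simp_all add: I_def \<T>_def \<S>_def)
    show "\<forall>T\<in>\<T>. subspace T \<and> dim T + 1 \<le> k"
    proof (clarsimp simp: \<T>_def)
      fix \<tau> assume "\<tau> \<in> cells X" "aff_dim \<tau> = int k - 1"
      then show "subspace (direction_space \<tau>) \<and> Suc (dim (direction_space \<tau>)) \<le> k"
        using D(2)[of \<tau>] dim_direction_space[of \<tau>] subspace_direction_space[of \<tau>] by linarith
    qed
    show "\<forall>S\<in>\<S>. subspace S \<and> dim S + 2 \<le> k"
    proof (clarsimp simp: \<S>_def)
      fix \<tau> assume "\<tau> \<in> cells X" "aff_dim \<tau> \<le> int k - 2"
      then show "subspace (direction_space \<tau>) \<and> Suc (Suc (dim (direction_space \<tau>))) \<le> k"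
        using D(2)[of \<tau>] dim_direction_space[of \<tau>] subspace_direction_space[of \<tau>] by linarith
    qed
    show "\<forall>\<sigma>\<in>I. subspace (direction_space \<sigma>) \<and> dim (direction_space \<sigma>) = k \<and>
        feasible_directions \<sigma> \<omega> \<subseteq> direction_space \<sigma> \<and> closed (feasible_directions \<sigma> \<omega>) \<and>
        (\<exists>p\<in>feasible_directions \<sigma> \<omega>. direction_space \<sigma> \<subseteq> feasible_directions (feasible_directions \<sigma> \<omega>) p)"
    proof
      fix \<sigma> assume "\<sigma> \<in> I"
      then have \<sigma>: "\<sigma> \<in> facets X" "\<omega> \<in> \<sigma>" by (auto simp: I_def)
      note D\<sigma> = D[OF cell[OF \<sigma>(1)]]
      have "int (dim (direction_space \<sigma>)) = int k"
        using dim_direction_space[OF D\<sigma>(2)] pure \<sigma>(1) by (simp add: pure_dim_def)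
      moreover obtain q where q: "q \<in> rel_interior \<sigma>" using D\<sigma> rel_interior_eq_empty by blast
      then have "q \<in> \<sigma>" using rel_interior_subset by blast
      \<comment> \<open>For \<open>q\<close> in the relative interior of \<open>\<sigma>\<close>,
        the vector \<open>q - \<omega>\<close> is interior to the cone; the transfer from
        \<open>\<sigma>\<close> uses step length 1.\<close>
      moreover have "direction_space \<sigma> \<subseteq> feasible_directions (feasible_directions \<sigma> \<omega>) (q - \<omega>)"
        using direction_space_subset_feasible_directions[OF q]
        by (intro subsetI feasible_directions_link[of \<sigma> \<omega> 1] D\<sigma>(3) \<sigma>(2)) auto
      ultimately show "subspace (direction_space \<sigma>) \<and> dim (direction_space \<sigma>) = k \<and>
        feasible_directions \<sigma> \<omega> \<subseteq> direction_space \<sigma> \<and> closed (feasible_directions \<sigma> \<omega>) \<and>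
        (\<exists>p\<in>feasible_directions \<sigma> \<omega>. direction_space \<sigma> \<subseteq> feasible_directions (feasible_directions \<sigma> \<omega>) p)"
        using subspace_direction_space[OF D\<sigma>(2)] closed_feasible_directions[OF D\<sigma>(1) \<sigma>(2)]
          feasible_directions_subset_direction_space[OF \<sigma>(2)] feasible_directions_diff[OF D\<sigma>(3) \<sigma>(2)]
        by auto
    qed
    show "\<forall>\<sigma>\<in>I. \<forall>u\<in>feasible_directions \<sigma> \<omega>.
        direction_space \<sigma> \<subseteq> feasible_directions (feasible_directions \<sigma> \<omega>) u \<or>
        (\<exists>T\<in>\<T>. \<exists>J. \<sigma> \<in> J \<and> linear_star I direction_space (\<lambda>\<sigma>. feasible_directions \<sigma> \<omega>) u T J) \<or>
        (\<exists>S\<in>\<S>. u \<in> S)"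
    proof (intro ballI)
      fix \<sigma> u assume "\<sigma> \<in> I" and u: "u \<in> feasible_directions \<sigma> \<omega>"
      then have \<sigma>: "\<sigma> \<in> facets X" "\<omega> \<in> \<sigma>" by (auto simp: I_def)
      note D\<sigma> = D[OF cell[OF \<sigma>(1)]]
      have "\<forall>\<^sub>F \<epsilon> in at_right 0. \<forall>\<rho>\<in>{\<rho> \<in> cells X. \<omega> \<notin> \<rho>}. \<omega> + \<epsilon> *\<^sub>R u \<notin> \<rho>"
        using fin D(4) by (intro eventually_ball_finite ballI eventually_not_in_closed) auto
      moreover have "\<forall>\<^sub>F \<epsilon> in at_right 0. \<omega> + \<epsilon> *\<^sub>R u \<in> \<sigma>"
        using u by (simp add: feasible_directions_def)
      moreover have "\<forall>\<^sub>F \<epsilon> in at_right (0::real). 0 < \<epsilon>" by (rule eventually_at_right_less)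
      ultimately have "\<forall>\<^sub>F \<epsilon> in at_right 0. (\<forall>\<rho>\<in>{\<rho> \<in> cells X. \<omega> \<notin> \<rho>}. \<omega> + \<epsilon> *\<^sub>R u \<notin> \<rho>) \<and>
          \<omega> + \<epsilon> *\<^sub>R u \<in> \<sigma> \<and> 0 < \<epsilon>"
        by (intro eventually_conj)
      \<comment> \<open>So small that no cell missing \<open>\<omega>\<close> is met. Hence the cell
        \<open>\<tau>\<close> found below contains \<open>\<omega>\<close>, and so do all facets
        around it.\<close>
      then obtain \<epsilon> where \<epsilon>: "\<forall>\<rho>\<in>{\<rho> \<in> cells X. \<omega> \<notin> \<rho>}. \<omega> + \<epsilon> *\<^sub>R u \<notin> \<rho>"
          "\<omega> + \<epsilon> *\<^sub>R u \<in> \<sigma>" "0 < \<epsilon>"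
        using eventually_happens' trivial_limit_at_right_real by blast
      define q where "q = \<omega> + \<epsilon> *\<^sub>R u"
      obtain \<tau> where \<tau>: "\<tau> \<in> cells X" "\<tau> \<subseteq> \<sigma>" "q \<in> rel_interior \<tau>"
        using polyhedral_complex_rel_interior[OF cpx cell[OF \<sigma>(1)]] \<epsilon>(2) q_def by blast
      note D\<tau> = D[OF \<tau>(1)]
      have q\<tau>: "q \<in> \<tau>" using \<tau>(3) rel_interior_subset by blast
      then have \<omega>\<tau>: "\<omega> \<in> \<tau>" using \<epsilon>(1) \<tau>(1) q_def by blast
      have "\<epsilon> *\<^sub>R u \<in> direction_space \<tau>" using diff_in_direction_space[OF q\<tau> \<omega>\<tau>] by (simp add: q_def)
      then have "(1/\<epsilon>) *\<^sub>R \<epsilon> *\<^sub>R u \<in> direction_space \<tau>"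
        by (rule subspace_scale[OF subspace_direction_space[OF D\<tau>(2)]])
      then have u\<tau>: "u \<in> direction_space \<tau>" using \<epsilon>(3) by simp
      have link: "w \<in> feasible_directions (feasible_directions \<rho> \<omega>) u"
        if "\<rho> \<in> cells X" "\<omega> \<in> \<rho>" "w \<in> feasible_directions \<rho> q" for \<rho> w
        using that D(3) \<epsilon>(3) unfolding q_def by (intro feasible_directions_link) auto
      have \<tau>_face: "\<tau> face_of \<sigma>"
        using cpx \<tau>(1,2) cell[OF \<sigma>(1)] unfolding polyhedral_complex_def by (metis inf.absorb2)
      consider "\<tau> = \<sigma>" | "aff_dim \<tau> = int k - 1" | "aff_dim \<tau> \<le> int k - 2"
        using face_of_aff_dim_lt[OF D\<sigma>(3) \<tau>_face] pure \<sigma>(1) by (fastforce simp: pure_dim_def)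
      then show "direction_space \<sigma> \<subseteq> feasible_directions (feasible_directions \<sigma> \<omega>) u \<or>
        (\<exists>T\<in>\<T>. \<exists>J. \<sigma> \<in> J \<and> linear_star I direction_space (\<lambda>\<sigma>. feasible_directions \<sigma> \<omega>) u T J) \<or>
        (\<exists>S\<in>\<S>. u \<in> S)"
      proof cases
        case 1
        then have "direction_space \<sigma> \<subseteq> feasible_directions (feasible_directions \<sigma> \<omega>) u"
          using direction_space_subset_feasible_directions[OF \<tau>(3)] link[OF \<tau>(1) \<omega>\<tau>] by auto
        then show ?thesis by (rule disjI1)
      next
        case 3
        then have "direction_space \<tau> \<in> \<S>" using \<tau>(1) by (auto simp: \<S>_def)
        then have "\<exists>S\<in>\<S>. u \<in> S" using u\<tau> by blast
        then show ?thesis by (intro disjI2)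
      next
        case 2
        define J where "J = {\<sigma> \<in> facets X. \<tau> \<subseteq> \<sigma>}"
        have "\<tau> \<in> ridges k X" using 2 \<tau>(1) by (simp add: ridges_def)
        from bspec[OF bal[unfolded balanced_def] this] obtain v
          where "\<forall>\<sigma>\<in>facets X. \<tau> \<subseteq> \<sigma> \<longrightarrow> primitive_normal \<tau> \<sigma> (v \<sigma>)"
          and sum: "(\<Sum>\<sigma>\<in>J. of_rat (mult X \<sigma>) *\<^sub>R v \<sigma>) \<in> rat_span (parallel_lattice \<tau>)"
          by (elim exE conjE) (rule that, assumption, simp add: J_def)
        then have v: "\<And>\<sigma>. \<sigma> \<in> J \<Longrightarrow> primitive_normal \<tau> \<sigma> (v \<sigma>)"
          by (simp add: J_def)
        have sub\<tau>: "subspace (direction_space \<tau>)" by (rule subspace_direction_space[OF D\<tau>(2)])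
        have "linear_star I direction_space (\<lambda>\<sigma>. feasible_directions \<sigma> \<omega>) u (direction_space \<tau>) J"
          unfolding linear_star_def
        proof (intro conjI exI[of _ v] exI[of _ "\<lambda>\<sigma>. of_rat (mult X \<sigma>)"] ballI allI impI)
          show "u \<in> direction_space \<tau>" by (rule u\<tau>)
          show "J \<subseteq> I" using \<omega>\<tau> by (auto simp: J_def I_def)
          show "finite J" using finite_facets[OF cpx] by (simp add: J_def)
          have "rat_span (parallel_lattice \<tau>) \<subseteq> direction_space \<tau>"
            by (rule rat_span_subset[OF sub\<tau>]) (simp add: parallel_lattice_eq)
          then show "(\<Sum>\<sigma>\<in>J. of_rat (mult X \<sigma>) *\<^sub>R v \<sigma>) \<in> direction_space \<tau>" using sum by blast
          fix \<rho> assume \<rho>: "\<rho> \<in> J"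
          then have \<rho>': "\<rho> \<in> facets X" "\<tau> \<subseteq> \<rho>" by (auto simp: J_def)
          note D\<rho> = D[OF cell[OF \<rho>'(1)]]
          show "(0::real) < of_rat (mult X \<rho>)"
            using X(2) \<rho>' by (simp add: positive_multiplicities_def)
          show "direction_space \<rho> = {x + c *\<^sub>R v \<rho> |x c. x \<in> direction_space \<tau>}"
            by (rule primitive_normal_direction_space[OF D\<rho>(1) \<rho>'(2) D\<tau>(2) v[OF \<rho>]])
          fix x and c :: real assume x: "x \<in> direction_space \<tau>" and c: "0 \<le> c"
          have x': "x \<in> feasible_directions \<rho> q"
            using x direction_space_subset_feasible_directions[OF \<tau>(3)] feasible_directions_mono[OF \<rho>'(2)]
            by blast
          have "x + c *\<^sub>R v \<rho> \<in> feasible_directions \<rho> q"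
          proof (cases "c = 0")
            case True
            then show ?thesis using x' by simp
          next
            case False
            \<comment> \<open>The normal is feasible at some relative interior point
              \<open>p\<close> of \<open>\<tau>\<close>, which need not be \<open>q\<close>;
              relative interiority of \<open>q\<close> lets it be moved there.\<close>
            obtain p where p: "p \<in> rel_interior \<tau>" "v \<rho> \<in> feasible_directions \<rho> p"
              using v[OF \<rho>] unfolding primitive_normal_def link_cell_eq by blast
            then have "p \<in> \<tau>" using rel_interior_subset by blast
            then have "v \<rho> \<in> feasible_directions \<rho> q"
              using feasible_directions_rel_interior[OF D\<tau>(3) \<rho>'(2) D\<rho>(3) _ \<tau>(3) p(2)] by blast
            then have "c *\<^sub>R v \<rho> \<in> feasible_directions \<rho> q"
              by (rule feasible_directions_scale) (use c False in simp)
            then show ?thesis by (rule feasible_directions_add[OF D\<rho>(3) x'])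
          qed
          then show "x + c *\<^sub>R v \<rho> \<in> feasible_directions (feasible_directions \<rho> \<omega>) u"
            using \<omega>\<tau> \<rho>'(2) by (intro link cell \<rho>'(1)) auto
        qed
        moreover have "direction_space \<tau> \<in> \<T>" using 2 \<tau>(1) by (auto simp: \<T>_def)
        moreover have "\<sigma> \<in> J" using \<sigma>(1) \<tau>(2) by (simp add: J_def)
        ultimately have "\<exists>T\<in>\<T>. \<exists>J. \<sigma> \<in> J \<and>
            linear_star I direction_space (\<lambda>\<sigma>. feasible_directions \<sigma> \<omega>) u T J" by (intro bexI exI conjI)
        then show ?thesis by (intro disjI2 disjI1)
      qed
    qed
  qed
  then show ?thesis using that unfolding I_def by blast
qed

text \<open>Subtraction on the product of the two link fans is a linear map on a balanced fan, and
  the pair of \<open>\<sigma>\<close> and \<open>\<tau>\<close> provides a cell on whose span it is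
  onto.\<close>

proposition link_diff_UNIV:
  fixes X Y :: "(real ^ 'n) weighted_complex"
  assumes X: "tropical_cycle k X" "positive_multiplicities X"
    and Y: "tropical_cycle l Y" "positive_multiplicities Y"
    and \<sigma>: "\<sigma> \<in> facets X" "\<omega> \<in> \<sigma>" and \<tau>: "\<tau> \<in> facets Y" "\<omega> \<in> \<tau>"
    and sum: "{x + y |x y. x \<in> direction_space \<sigma> \<and> y \<in> direction_space \<tau>} = UNIV"
  shows "\<exists>\<sigma>\<in>facets X. \<exists>\<tau>\<in>facets Y. \<omega> \<in> \<sigma> \<and> \<omega> \<in> \<tau> \<and>
    (\<exists>s\<in>feasible_directions \<sigma> \<omega>. \<exists>t\<in>feasible_directions \<tau> \<omega>. w = s - t)"
proof -
  obtain \<T> \<S> where fX: "balanced_fan k {\<sigma> \<in> facets X. \<omega> \<in> \<sigma>} direction_space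
      (\<lambda>\<sigma>. feasible_directions \<sigma> \<omega>) \<T> \<S>"
    using balanced_fan_link[OF X] by blast
  obtain \<T>' \<S>' where fY: "balanced_fan l {\<sigma> \<in> facets Y. \<omega> \<in> \<sigma>} direction_space
      (\<lambda>\<sigma>. feasible_directions \<sigma> \<omega>) \<T>' \<S>'"
    using balanced_fan_link[OF Y] by blast
  obtain \<U> \<V> where fan: "balanced_fan (k + l) ({\<sigma> \<in> facets X. \<omega> \<in> \<sigma>} \<times> {\<sigma> \<in> facets Y. \<omega> \<in> \<sigma>})
      (\<lambda>(i, j). direction_space i \<times> direction_space j)
      (\<lambda>(i, j). feasible_directions i \<omega> \<times> feasible_directions j \<omega>) \<U> \<V>"
    using balanced_fan_Times[OF fX fY] by blast
  define \<phi> :: "(real ^ 'n) \<times> (real ^ 'n) \<Rightarrow> real ^ 'n" where "\<phi> z = fst z - snd z" for z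
  have \<phi>: "linear \<phi>" unfolding \<phi>_def by (intro linearI) (auto simp: algebra_simps)
  have "\<tau> \<noteq> {}" using \<tau> by blast
  \<comment> \<open>The hypothesis speaks of sums while \<open>\<phi>\<close> subtracts, so second
    components change sign.\<close>
  then have neg: "- y \<in> direction_space \<tau>" if "y \<in> direction_space \<tau>" for y
    using that subspace_neg subspace_direction_space by blast
  have surj: "\<phi> ` (direction_space \<sigma> \<times> direction_space \<tau>) = UNIV"
  proof (rule UNIV_eq_I[symmetric])
    fix z
    have "z \<in> {x + y |x y. x \<in> direction_space \<sigma> \<and> y \<in> direction_space \<tau>}" unfolding sum by simp
    then obtain x y where "z = x + y" "x \<in> direction_space \<sigma>" "y \<in> direction_space \<tau>" by blast
    then show "z \<in> \<phi> ` (direction_space \<sigma> \<times> direction_space \<tau>)"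
      using neg by (intro image_eqI[of _ _ "(x, - y)"]) (auto simp: \<phi>_def)
  qed
  have "\<exists>i\<in>{\<sigma> \<in> facets X. \<omega> \<in> \<sigma>} \<times> {\<sigma> \<in> facets Y. \<omega> \<in> \<sigma>}.
      w \<in> \<phi> ` (case i of (i, j) \<Rightarrow> feasible_directions i \<omega> \<times> feasible_directions j \<omega>)"
    by (rule balanced_fan_image_surj[OF fan, of "(\<sigma>, \<tau>)"]) (use \<sigma> \<tau> \<phi> surj in auto)
  then show ?thesis by (fastforce simp: \<phi>_def)
qed

section \<open>Supports in terms of feasible directions\<close>

lemma supp_eq_Union_facets: "positive_multiplicities X \<Longrightarrow> supp X = \<Union>(facets X)"
  by (force simp: supp_def positive_multiplicities_def)

text \<open>Among the cells through \<open>\<omega>\<close>, \<open>link_cell \<omega>\<close>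
  preserves and reflects inclusion. It is therefore injective, which evaluates the
  \<open>THE\<close> in \<open>link\<close>, and it matches facets with facets.\<close>

lemma supp_link:
  fixes X :: "(real ^ 'n) weighted_complex"
  assumes cpx: "polyhedral_complex (cells X)" and pos: "positive_multiplicities X"
  shows "supp (link \<omega> X) = (\<Union>\<sigma>\<in>{\<sigma> \<in> facets X. \<omega> \<in> \<sigma>}. link_cell \<omega> \<sigma>)"
proof (cases "\<omega> \<in> supp X")
  case False
  then have "{\<sigma> \<in> facets X. \<omega> \<in> \<sigma>} = {}" using supp_eq_Union_facets[OF pos] by blast
  moreover have "cells (link \<omega> X) = {}" using False by (simp add: link_def)
  then have "supp (link \<omega> X) = {}" by (simp add: supp_def facets_def)
  ultimately show ?thesis by (simp only: UN_empty)
next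
  case True
  \<comment> \<open>An inner point of the segment from \<open>\<omega>\<close> to \<open>x\<close>
    lies in both cells. Their intersection is a face of \<open>\<sigma>\<close>, so it contains the
    end point \<open>x\<close> as well.\<close>
  have sub: "\<sigma> \<subseteq> \<sigma>'"
    if \<sigma>: "\<sigma> \<in> cells X" "\<omega> \<in> \<sigma>" and \<sigma>': "\<sigma>' \<in> cells X" "\<omega> \<in> \<sigma>'"
      and le: "link_cell \<omega> \<sigma> \<subseteq> link_cell \<omega> \<sigma>'" for \<sigma> \<sigma>'
  proof
    fix x assume x: "x \<in> \<sigma>"
    have face: "\<sigma> \<inter> \<sigma>' face_of \<sigma>" using cpx \<sigma>(1) \<sigma>'(1) unfolding polyhedral_complex_def by blast
    have conv: "convex \<sigma>" by (rule polyhedral_complexD(3)[OF cpx \<sigma>(1)])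
    have "x - \<omega> \<in> feasible_directions \<sigma>' \<omega>"
      using le feasible_directions_diff[OF conv \<sigma>(2) x] by (auto simp: link_cell_eq)
    then obtain \<epsilon> where \<epsilon>: "0 < \<epsilon>" "\<epsilon> < 1" "\<omega> + \<epsilon> *\<^sub>R (x - \<omega>) \<in> \<sigma>'" by (rule feasible_directionsE)
    have eq: "\<omega> + \<epsilon> *\<^sub>R (x - \<omega>) = (1 - \<epsilon>) *\<^sub>R \<omega> + \<epsilon> *\<^sub>R x" by (simp add: algebra_simps)
    have "(1 - \<epsilon>) *\<^sub>R \<omega> + \<epsilon> *\<^sub>R x \<in> \<sigma>" by (rule convexD[OF conv \<sigma>(2) x]) (use \<epsilon> in auto)
    then have mem: "\<omega> + \<epsilon> *\<^sub>R (x - \<omega>) \<in> \<sigma> \<inter> \<sigma>'" using \<epsilon> eq by simp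
    show "x \<in> \<sigma>'"
    proof (cases "x = \<omega>")
      case True
      then show ?thesis using \<sigma>' by simp
    next
      case False
      then have "\<omega> + \<epsilon> *\<^sub>R (x - \<omega>) \<in> open_segment \<omega> x"
        using \<epsilon> by (auto simp: eq in_segment)
      from face_ofD[OF face this \<sigma>(2) x mem] show ?thesis by blast
    qed
  qed
  have mono: "link_cell \<omega> \<sigma> \<subseteq> link_cell \<omega> \<sigma>'" if "\<sigma> \<subseteq> \<sigma>'" for \<sigma> \<sigma>'
    using feasible_directions_mono[OF that] by (simp add: link_cell_eq)
  have cells: "cells (link \<omega> X) = link_cell \<omega> ` {\<sigma> \<in> cells X. \<omega> \<in> \<sigma>}"
    using True by (auto simp: link_def)
  have mult: "mult (link \<omega> X) (link_cell \<omega> \<sigma>) = mult X \<sigma>" if "\<sigma> \<in> cells X" "\<omega> \<in> \<sigma>" for \<sigma>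
  proof -
    have "(THE \<sigma>'. \<sigma>' \<in> cells X \<and> \<omega> \<in> \<sigma>' \<and> link_cell \<omega> \<sigma>' = link_cell \<omega> \<sigma>) = \<sigma>"
      by (rule the_equality) (use that sub in blast)+
    then show ?thesis by (simp add: link_def)
  qed
  have facets: "facets (link \<omega> X) = link_cell \<omega> ` {\<sigma> \<in> facets X. \<omega> \<in> \<sigma>}"
  proof (intro equalityI subsetI)
    fix \<rho> assume \<rho>: "\<rho> \<in> facets (link \<omega> X)"
    then obtain \<sigma> where \<sigma>: "\<rho> = link_cell \<omega> \<sigma>" "\<sigma> \<in> cells X" "\<omega> \<in> \<sigma>"
      unfolding facets_def cells by blast
    have "\<sigma>' = \<sigma>" if "\<sigma>' \<in> cells X" "\<sigma> \<subseteq> \<sigma>'" for \<sigma>'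
    proof -
      have "\<omega> \<in> \<sigma>'" using that \<sigma> by blast
      then have "link_cell \<omega> \<sigma>' = \<rho>"
        using \<rho> that(1) mono[OF that(2)] unfolding facets_def cells \<sigma>(1) by blast
      then show ?thesis using sub[OF that(1) \<open>\<omega> \<in> \<sigma>'\<close> \<sigma>(2,3)] that(2) \<sigma>(1) by blast
    qed
    then show "\<rho> \<in> link_cell \<omega> ` {\<sigma> \<in> facets X. \<omega> \<in> \<sigma>}" using \<sigma> by (auto simp: facets_def)
  next
    fix \<rho> assume "\<rho> \<in> link_cell \<omega> ` {\<sigma> \<in> facets X. \<omega> \<in> \<sigma>}"
    then obtain \<sigma> where \<sigma>: "\<rho> = link_cell \<omega> \<sigma>" "\<sigma> \<in> facets X" "\<omega> \<in> \<sigma>" by blast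
    have \<sigma>c: "\<sigma> \<in> cells X" and max: "\<And>\<sigma>'. \<sigma>' \<in> cells X \<Longrightarrow> \<sigma> \<subseteq> \<sigma>' \<Longrightarrow> \<sigma>' = \<sigma>"
      using \<sigma>(2) by (auto simp: facets_def)
    have "link_cell \<omega> \<sigma>' = \<rho>" if "\<sigma>' \<in> cells X" "\<omega> \<in> \<sigma>'" "\<rho> \<subseteq> link_cell \<omega> \<sigma>'" for \<sigma>'
      using max[OF that(1)] sub[OF \<sigma>c \<sigma>(3) that(1,2)] that(3) \<sigma>(1) by blast
    then have "\<rho>' = \<rho>" if "\<rho>' \<in> cells (link \<omega> X)" "\<rho> \<subseteq> \<rho>'" for \<rho>'
      using that unfolding cells by blast
    moreover have "\<rho> \<in> cells (link \<omega> X)" unfolding cells \<sigma>(1) using \<sigma>c \<sigma>(3) by blast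
    ultimately show "\<rho> \<in> facets (link \<omega> X)" by (simp add: facets_def)
  qed
  have "mult (link \<omega> X) \<rho> \<noteq> 0" if \<rho>: "\<rho> \<in> facets (link \<omega> X)" for \<rho>
  proof -
    obtain \<sigma> where \<sigma>: "\<rho> = link_cell \<omega> \<sigma>" "\<sigma> \<in> facets X" "\<omega> \<in> \<sigma>"
      using \<rho> unfolding facets by blast
    then have "\<sigma> \<in> cells X" by (simp add: facets_def)
    then have "mult (link \<omega> X) \<rho> = mult X \<sigma>" using mult \<sigma> by blast
    then show ?thesis using pos \<sigma>(2) by (auto simp: positive_multiplicities_def)
  qed
  then have "supp (link \<omega> X) = \<Union>(facets (link \<omega> X))" by (auto simp: supp_def)
  then show ?thesis unfolding facets by simp
qed

text \<open>Near \<open>\<omega>\<close> only facets through \<open>\<omega>\<close> matter, and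
  there they coincide with their cones. A common point near \<open>\<omega>\<close> has the form
  \<open>\<omega> + \<epsilon> *\<^sub>R s = \<omega> + \<epsilon> *\<^sub>R t + \<epsilon>
  *\<^sub>R v\<close> with \<open>s\<close> and \<open>t\<close> in such cones, which means
  \<open>v = s - t\<close>.\<close>

lemma limit_set_supp_eq:
  fixes X Y :: "(real ^ 'n) weighted_complex"
  assumes X: "polyhedral_complex (cells X)" "positive_multiplicities X"
    and Y: "polyhedral_complex (cells Y)" "positive_multiplicities Y"
  shows "limit_set (\<lambda>\<epsilon>. supp X \<inter> {y + \<epsilon> *\<^sub>R v |y. y \<in> supp Y}) =
    {\<omega>. \<exists>\<sigma>\<in>facets X. \<exists>\<tau>\<in>facets Y. \<omega> \<in> \<sigma> \<and> \<omega> \<in> \<tau> \<and>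
      (\<exists>s\<in>feasible_directions \<sigma> \<omega>. \<exists>t\<in>feasible_directions \<tau> \<omega>. v = s - t)}"
proof -
  have X': "convex \<sigma>" "closed \<sigma>" if "\<sigma> \<in> facets X" for \<sigma>
    using that polyhedral_complexD[OF X(1)] by (auto simp: facets_def)
  have Y': "convex \<sigma>" "closed \<sigma>" if "\<sigma> \<in> facets Y" for \<sigma>
    using that polyhedral_complexD[OF Y(1)] by (auto simp: facets_def)
  show ?thesis
  proof (intro equalityI subsetI)
    fix \<omega> assume \<omega>: "\<omega> \<in> limit_set (\<lambda>\<epsilon>. supp X \<inter> {y + \<epsilon> *\<^sub>R v |y. y \<in> supp Y})"
    \<comment> \<open>A facet meeting a ball around \<open>\<omega>\<close> disjoint from
      \<open>F\<close> must contain \<open>\<omega>\<close>. Both \<open>y\<close> and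
      \<open>y + \<epsilon> *\<^sub>R v\<close> have to lie in this ball, whence the two bounds by
      \<open>r/2\<close>.\<close>
    define F where "F = \<Union>{\<sigma> \<in> facets X \<union> facets Y. \<omega> \<notin> \<sigma>}"
    have "closed F" unfolding F_def
      using finite_facets[OF X(1)] finite_facets[OF Y(1)] X' Y' by (intro closed_Union) auto
    then have "open (- F)" by (rule open_Compl)
    moreover have "\<omega> \<in> - F" by (simp add: F_def)
    ultimately obtain r where r: "r > 0" "ball \<omega> r \<subseteq> - F" by (auto simp: open_contains_ball)
    have "\<forall>\<^sub>F \<epsilon> in at_right 0. \<exists>x\<in>supp X \<inter> {y + \<epsilon> *\<^sub>R v |y. y \<in> supp Y}. dist x \<omega> < r/2"
      using \<omega>[unfolded limit_set_def mem_Collect_eq] half_gt_zero[OF r(1)] by blast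
    moreover have "((\<lambda>\<epsilon>. norm (\<epsilon> *\<^sub>R v)) \<longlongrightarrow> norm (0 *\<^sub>R v)) (at_right (0::real))"
      by (intro tendsto_intros)
    then have "\<forall>\<^sub>F \<epsilon> in at_right (0::real). norm (\<epsilon> *\<^sub>R v) < r/2"
      using r by (intro order_tendstoD(2)) auto
    moreover have "\<forall>\<^sub>F \<epsilon> in at_right (0::real). 0 < \<epsilon>" by (rule eventually_at_right_less)
    ultimately have "\<forall>\<^sub>F \<epsilon> in at_right 0.
        (\<exists>x\<in>supp X \<inter> {y + \<epsilon> *\<^sub>R v |y. y \<in> supp Y}. dist x \<omega> < r/2) \<and> norm (\<epsilon> *\<^sub>R v) < r/2 \<and> 0 < \<epsilon>"
      by (intro eventually_conj)
    then obtain \<epsilon> where "\<exists>x\<in>supp X \<inter> {y + \<epsilon> *\<^sub>R v |y. y \<in> supp Y}. dist x \<omega> < r/2"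
      and \<epsilon>: "norm (\<epsilon> *\<^sub>R v) < r/2" "0 < \<epsilon>"
      using eventually_happens' trivial_limit_at_right_real by blast
    then obtain y where y: "y + \<epsilon> *\<^sub>R v \<in> supp X" "y \<in> supp Y" "dist (y + \<epsilon> *\<^sub>R v) \<omega> < r/2" by blast
    have "dist y \<omega> < r"
    proof -
      have "dist y \<omega> \<le> dist y (y + \<epsilon> *\<^sub>R v) + dist (y + \<epsilon> *\<^sub>R v) \<omega>" by (rule dist_triangle)
      also have "dist y (y + \<epsilon> *\<^sub>R v) = norm (\<epsilon> *\<^sub>R v)" by (simp add: dist_norm)
      finally show ?thesis using y \<epsilon> by linarith
    qed
    then have near: "y \<notin> F" "y + \<epsilon> *\<^sub>R v \<notin> F" using r y by (auto simp: dist_commute subset_iff)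
    obtain \<sigma> \<tau> where \<sigma>: "\<sigma> \<in> facets X" "y + \<epsilon> *\<^sub>R v \<in> \<sigma>" and \<tau>: "\<tau> \<in> facets Y" "y \<in> \<tau>"
      using y supp_eq_Union_facets[OF X(2)] supp_eq_Union_facets[OF Y(2)] by auto
    have \<omega>': "\<omega> \<in> \<sigma>" "\<omega> \<in> \<tau>" using near \<sigma> \<tau> by (auto simp: F_def)
    have "(1/\<epsilon>) *\<^sub>R (y + \<epsilon> *\<^sub>R v - \<omega>) \<in> feasible_directions \<sigma> \<omega>"
      by (rule feasible_directions_scale[OF feasible_directions_diff]) (use X' \<sigma> \<omega>' \<epsilon> in auto)
    moreover have "(1/\<epsilon>) *\<^sub>R (y - \<omega>) \<in> feasible_directions \<tau> \<omega>"
      by (rule feasible_directions_scale[OF feasible_directions_diff]) (use Y' \<tau> \<omega>' \<epsilon> in auto)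
    moreover have "v = (1/\<epsilon>) *\<^sub>R (y + \<epsilon> *\<^sub>R v - \<omega>) - (1/\<epsilon>) *\<^sub>R (y - \<omega>)"
      using \<epsilon> by (simp add: algebra_simps)
    ultimately show "\<omega> \<in> {\<omega>. \<exists>\<sigma>\<in>facets X. \<exists>\<tau>\<in>facets Y. \<omega> \<in> \<sigma> \<and> \<omega> \<in> \<tau> \<and>
      (\<exists>s\<in>feasible_directions \<sigma> \<omega>. \<exists>t\<in>feasible_directions \<tau> \<omega>. v = s - t)}"
      using \<sigma> \<tau> \<omega>' by blast
  next
    fix \<omega> assume "\<omega> \<in> {\<omega>. \<exists>\<sigma>\<in>facets X. \<exists>\<tau>\<in>facets Y. \<omega> \<in> \<sigma> \<and> \<omega> \<in> \<tau> \<and>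
      (\<exists>s\<in>feasible_directions \<sigma> \<omega>. \<exists>t\<in>feasible_directions \<tau> \<omega>. v = s - t)}"
    then obtain \<sigma> \<tau> s t where st: "\<sigma> \<in> facets X" "\<tau> \<in> facets Y" "s \<in> feasible_directions \<sigma> \<omega>"
      "t \<in> feasible_directions \<tau> \<omega>" "v = s - t" by blast
    show "\<omega> \<in> limit_set (\<lambda>\<epsilon>. supp X \<inter> {y + \<epsilon> *\<^sub>R v |y. y \<in> supp Y})"
      unfolding limit_set_def mem_Collect_eq
    proof (intro allI impI)
      fix \<delta> :: real assume "\<delta> > 0"
      have "((\<lambda>\<epsilon>. \<omega> + \<epsilon> *\<^sub>R s) \<longlongrightarrow> \<omega> + 0 *\<^sub>R s) (at_right 0)" by (intro tendsto_intros)
      then have "\<forall>\<^sub>F \<epsilon> in at_right 0. dist (\<omega> + \<epsilon> *\<^sub>R s) \<omega> < \<delta>"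
        using tendstoD[OF _ \<open>\<delta> > 0\<close>] by fastforce
      moreover have "\<forall>\<^sub>F \<epsilon> in at_right 0. \<omega> + \<epsilon> *\<^sub>R s \<in> \<sigma>" "\<forall>\<^sub>F \<epsilon> in at_right 0. \<omega> + \<epsilon> *\<^sub>R t \<in> \<tau>"
        using st by (auto simp: feasible_directions_def)
      ultimately show "\<forall>\<^sub>F \<epsilon> in at_right 0. \<exists>x\<in>supp X \<inter> {y + \<epsilon> *\<^sub>R v |y. y \<in> supp Y}. dist x \<omega> < \<delta>"
      proof eventually_elim
        case (elim \<epsilon>)
        have "\<omega> + \<epsilon> *\<^sub>R s = (\<omega> + \<epsilon> *\<^sub>R t) + \<epsilon> *\<^sub>R v" by (simp add: st(5) scaleR_diff_right)
        moreover have "\<omega> + \<epsilon> *\<^sub>R s \<in> supp X" "\<omega> + \<epsilon> *\<^sub>R t \<in> supp Y"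
          using elim st supp_eq_Union_facets[OF X(2)] supp_eq_Union_facets[OF Y(2)] by auto
        ultimately show ?case using elim(1) by blast
      qed
    qed
  qed
qed

text \<open>Brings the stable intersection into the shape of \<open>limit_set_supp_eq\<close>, with
  every \<open>w\<close> in place of the single \<open>v\<close>.\<close>

lemma stable_intersection_supp_eq:
  fixes X Y :: "(real ^ 'n) weighted_complex"
  assumes "polyhedral_complex (cells X)" "positive_multiplicities X"
    and "polyhedral_complex (cells Y)" "positive_multiplicities Y"
  shows "stable_intersection_supp X Y =
    {\<omega>. \<forall>w. \<exists>\<sigma>\<in>facets X. \<exists>\<tau>\<in>facets Y. \<omega> \<in> \<sigma> \<and> \<omega> \<in> \<tau> \<and>
      (\<exists>s\<in>feasible_directions \<sigma> \<omega>. \<exists>t\<in>feasible_directions \<tau> \<omega>. w = s - t)}"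
proof -
  have UNIV: "({s - t |s t. s \<in> A \<and> t \<in> B} = UNIV) \<longleftrightarrow> (\<forall>w. \<exists>s\<in>A. \<exists>t\<in>B. w = s - t)"
    for A B :: "(real ^ 'n) set"
    unfolding set_eq_iff[of _ UNIV] mem_Collect_eq by (simp add: Bex_def) metis
  have UN: "(\<exists>s\<in>(\<Union>\<sigma>\<in>{\<sigma> \<in> A. \<omega> \<in> \<sigma>}. f \<sigma>). \<exists>t\<in>(\<Union>\<tau>\<in>{\<tau> \<in> B. \<omega> \<in> \<tau>}. f \<tau>). w = s - t) \<longleftrightarrow>
    (\<exists>\<sigma>\<in>A. \<exists>\<tau>\<in>B. \<omega> \<in> \<sigma> \<and> \<omega> \<in> \<tau> \<and> (\<exists>s\<in>f \<sigma>. \<exists>t\<in>f \<tau>. w = s - t))"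
    for A B and f :: "(real ^ 'n) set \<Rightarrow> (real ^ 'n) set" and \<omega> w
    by blast
  show ?thesis
    unfolding stable_intersection_supp_def supp_link[OF assms(1,2)] supp_link[OF assms(3,4)] link_cell_eq
      UNIV UN ..
qed

section \<open>Generic displacement vectors\<close>

lemma open_dense_Compl_subspaces:
  fixes \<U> :: "'a::euclidean_space set set"
  assumes "finite \<U>" "\<And>U. U \<in> \<U> \<Longrightarrow> subspace U \<and> U \<noteq> UNIV"
  shows "open (- \<Union>\<U>)" "closure (- \<Union>\<U>) = UNIV"
proof -
  show "open (- \<Union>\<U>)"
    using assms by (intro open_Compl closed_Union ballI) (simp_all add: closed_subspace)
  \<comment> \<open>One direction outside all the subspaces moves every point off their union by
    arbitrarily small steps, which gives density.\<close>
  obtain e where e: "\<And>U. U \<in> \<U> \<Longrightarrow> e \<notin> U"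
  proof (rule avoid_finitely_many_subspaces[OF assms(1) subspace_UNIV])
    show "subspace U \<and> \<not> UNIV \<subseteq> U" if "U \<in> \<U>" for U
      using assms(2)[OF that] by (simp add: top.extremum_unique)
  qed (rule that)
  show "closure (- \<Union>\<U>) = UNIV"
  proof (rule UNIV_eq_I[symmetric])
    fix x
    have "((\<lambda>\<epsilon>. x + \<epsilon> *\<^sub>R e) \<longlongrightarrow> x + 0 *\<^sub>R e) (at_right 0)" by (intro tendsto_intros)
    moreover have "\<forall>\<^sub>F \<epsilon> in at_right (0::real). \<forall>U\<in>\<U>. x + \<epsilon> *\<^sub>R e \<notin> U"
      using assms e by (intro eventually_ball_finite ballI eventually_notin_subspace) auto
    then have "\<forall>\<^sub>F \<epsilon> in at_right 0. x + \<epsilon> *\<^sub>R e \<in> closure (- \<Union>\<U>)"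
      by eventually_elim (rule subsetD[OF closure_subset], blast)
    ultimately have "x + 0 *\<^sub>R e \<in> closure (- \<Union>\<U>)"
      by (intro Lim_in_closed_set[OF closed_closure _ trivial_limit_at_right_real])
    then show "x \<in> closure (- \<Union>\<U>)" by simp
  qed
qed

theorem proposition2p7:
  fixes X Y :: "(real ^ 'n) weighted_complex" and k l :: nat
  assumes "tropical_cycle k X" and "positive_multiplicities X"
    and "tropical_cycle l Y" and "positive_multiplicities Y"
  shows "\<exists>G :: (real ^ 'n) set. open G \<and> closure G = UNIV \<and>
    (\<forall>v\<in>G. stable_intersection_supp X Y =
       limit_set (\<lambda>\<epsilon>. supp X \<inter> {y + \<epsilon> *\<^sub>R v |y. y \<in> supp Y})) \<and>
    (\<forall>v\<in>G. \<forall>w\<in>G.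
       limit_set (\<lambda>\<epsilon>. supp X \<inter> {y + \<epsilon> *\<^sub>R v |y. y \<in> supp Y}) =
       limit_set (\<lambda>\<epsilon>. supp X \<inter> {y + \<epsilon> *\<^sub>R w |y. y \<in> supp Y}))"
proof -
  have cX: "polyhedral_complex (cells X)" and cY: "polyhedral_complex (cells Y)"
    using assms by (auto simp: tropical_cycle_def)
  define S where "S = (\<lambda>(\<sigma>, \<tau> :: (real ^ 'n) set). {x + y |x y. x \<in> direction_space \<sigma> \<and> y \<in> direction_space \<tau>})"
  \<comment> \<open>Sums equal to the whole space are left out, so all members are proper subspaces.
    If some \<open>v\<close> in \<open>G\<close> lies in \<open>S (\<sigma>, \<tau>)\<close>, that
    sum must be the whole space.\<close>
  define \<U> where "\<U> = S ` (facets X \<times> facets Y) - {UNIV}"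
  define G where "G = - \<Union>\<U>"
  have "finite \<U>" using finite_facets[OF cX] finite_facets[OF cY] by (simp add: \<U>_def)
  moreover have "subspace U \<and> U \<noteq> UNIV" if U: "U \<in> \<U>" for U
  proof -
    obtain \<sigma> \<tau> where \<sigma>\<tau>: "U = S (\<sigma>, \<tau>)" "\<sigma> \<in> facets X" "\<tau> \<in> facets Y" and "U \<noteq> UNIV"
      using U unfolding \<U>_def by blast
    have "\<sigma> \<noteq> {}" "\<tau> \<noteq> {}"
      using \<sigma>\<tau> polyhedral_complexD(2)[OF cX, of \<sigma>] polyhedral_complexD(2)[OF cY, of \<tau>]
      by (simp_all add: facets_def)
    then have "subspace U" unfolding \<sigma>\<tau>(1) S_def prod.case
      by (intro subspace_sums subspace_direction_space)
    then show ?thesis using \<open>U \<noteq> UNIV\<close> by simp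
  qed
  ultimately have G: "open G" "closure G = UNIV"
    unfolding G_def by (intro open_dense_Compl_subspaces; blast)+
  have main: "stable_intersection_supp X Y =
      limit_set (\<lambda>\<epsilon>. supp X \<inter> {y + \<epsilon> *\<^sub>R v |y. y \<in> supp Y})" if "v \<in> G" for v
  proof -
    \<comment> \<open>\<open>Q \<omega> w\<close> says that \<open>w\<close> is a difference of
      vectors from the supports of the two links at \<open>\<omega>\<close>. The stable intersection
      asks for this for all \<open>w\<close>, the limit only for \<open>v\<close>, so it suffices
      that \<open>Q \<omega> v\<close> implies \<open>Q \<omega> w\<close>.\<close>
    define Q where "Q \<omega> w \<longleftrightarrow> (\<exists>\<sigma>\<in>facets X. \<exists>\<tau>\<in>facets Y. \<omega> \<in> \<sigma> \<and> \<omega> \<in> \<tau> \<and>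
        (\<exists>s\<in>feasible_directions \<sigma> \<omega>. \<exists>t\<in>feasible_directions \<tau> \<omega>. w = s - t))" for \<omega> w
    have "Q \<omega> w" if Q: "Q \<omega> v" for \<omega> w
    proof -
      obtain \<sigma> \<tau> s t where \<sigma>: "\<sigma> \<in> facets X" "\<omega> \<in> \<sigma>" and \<tau>: "\<tau> \<in> facets Y" "\<omega> \<in> \<tau>"
        and s: "s \<in> feasible_directions \<sigma> \<omega>" and t: "t \<in> feasible_directions \<tau> \<omega>" and v: "v = s - t"
        using Q unfolding Q_def by blast
      have "s \<in> direction_space \<sigma>"
        using s feasible_directions_subset_direction_space[OF \<sigma>(2)] by (rule subsetD[rotated])
      moreover have "t \<in> direction_space \<tau>"
        using t feasible_directions_subset_direction_space[OF \<tau>(2)] by (rule subsetD[rotated])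
      then have "- t \<in> direction_space \<tau>"
        using \<tau>(2) by (intro subspace_neg subspace_direction_space) auto
      moreover have "v = s + - t" using v by simp
      ultimately have "v \<in> S (\<sigma>, \<tau>)" unfolding S_def prod.case mem_Collect_eq by (intro exI conjI)
      moreover have "S (\<sigma>, \<tau>) \<in> S ` (facets X \<times> facets Y)" using \<sigma>(1) \<tau>(1) by (intro imageI SigmaI)
      ultimately have "S (\<sigma>, \<tau>) = UNIV" using \<open>v \<in> G\<close> unfolding G_def \<U>_def by blast
      then have "{x + y |x y. x \<in> direction_space \<sigma> \<and> y \<in> direction_space \<tau>} = UNIV"
        unfolding S_def prod.case .
      from link_diff_UNIV[OF assms \<sigma> \<tau> this] show ?thesis unfolding Q_def .
    qed
    then have "{\<omega>. \<forall>w. Q \<omega> w} = {\<omega>. Q \<omega> v}" by blast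
    then show ?thesis
      unfolding stable_intersection_supp_eq[OF cX assms(2) cY assms(4)]
        limit_set_supp_eq[OF cX assms(2) cY assms(4)] Q_def .
  qed
  show ?thesis
  proof (intro exI[of _ G] conjI ballI)
    fix v w assume "v \<in> G" "w \<in> G"
    show "limit_set (\<lambda>\<epsilon>. supp X \<inter> {y + \<epsilon> *\<^sub>R v |y. y \<in> supp Y}) =
        limit_set (\<lambda>\<epsilon>. supp X \<inter> {y + \<epsilon> *\<^sub>R w |y. y \<in> supp Y})"
      using main[OF \<open>v \<in> G\<close>] main[OF \<open>w \<in> G\<close>] by (rule trans[OF sym])
  qed (fact G main)+
qed

end
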